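(* Let $H$ be an infinite-dimensional separable complex Hilbert space and let $T\in\mathcal{B}(H)$ be such that $\mathcal{R}_T=\mathcal{R}_{|T|}$. Then the following are equivalent: (i) $T\in\mathcal{M}_r(H)$; (ii) there exist a countable set $\Lambda\subseteq[0,\|T\|]$, well-ordered by the usual order of $\mathbb{R}$, a family of mutually orthogonal projections $(P_\lambda)_{\lambda\in\Lambda}$ on $H$, and a family of partial isometries $(V_\lambda)_{\lambda\in\Lambda\setminus\{0\}}$ on $H$, with $\sum_{\lambda\in\Lambda}P_\lambda=I$ in the strong operator topology and $V_\mu^*V_\lambda=\delta_{\mu\lambda}P_\lambda$ for all $\lambda,\mu\in\Lambda\setminus\{0\}$, such that $$T=\sum_{\lambda\in\Lambda\setminus\{0\}}\lambda V_\lambda$$ in the strong operator topology.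
   Context: $\mathcal{B}(H)$ denotes the bounded linear operators on $H$; $|T|=(T^*T)^{1/2}$; projections are orthogonal projections; $\delta_{\mu\lambda}$ is the Kronecker delta. For a nonzero Hilbert space $M$ and $A\in\mathcal{B}(M)$, the minimum modulus is $m(A)=\inf\{\|Ax\|: x\in M,\ \|x\|=1\}$; $A$ is minimum attaining if there is a unit vector $x_0\in M$ with $\|Ax_0\|=m(A)$. A closed subspace $M\subseteq H$ reduces $T\in\mathcal{B}(H)$ if $T(M)\subseteq M$ and $T^*(M)\subseteq M$; $\mathcal{R}_T$ is the set of all closed subspaces reducing $T$. $\mathcal{M}_r(H)$ is the set of all $T\in\mathcal{B}(H)$ such that for every nonzero $M\in\mathcal{R}_T$, the restriction $T|_M:M\to M$ is minimum attaining. *)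

theory Defs
  imports "HOL-Analysis.Analysis"
begin

section \<open>Complex Hilbert spaces\<close>

class complex_vector = real_vector +
  fixes scaleC :: "complex \<Rightarrow> 'a \<Rightarrow> 'a" (infixr \<open>*\<^sub>C\<close> 75)
  assumes scaleC_add_right: "a *\<^sub>C (x + y) = a *\<^sub>C x + a *\<^sub>C y"
    and scaleC_add_left: "(a + b) *\<^sub>C x = a *\<^sub>C x + b *\<^sub>C x"
    and scaleC_scaleC: "a *\<^sub>C b *\<^sub>C x = (a * b) *\<^sub>C x"
    and scaleC_of_real: "of_real r *\<^sub>C x = r *\<^sub>R x"

global_interpretation complex_vector: vector_space "scaleC :: complex \<Rightarrow> 'a \<Rightarrow> 'a::complex_vector"
  defines csubspace = complex_vector.subspace
    and cspan = complex_vector.span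
proof
  fix a b :: complex and x y :: 'a
  show "1 *\<^sub>C x = x"
    using scaleC_of_real[of 1 x] by simp
qed (simp_all add: scaleC_add_right scaleC_add_left scaleC_scaleC)

text \<open>The inner product \<open>cinner\<close> is linear in the first argument. Positivity and the norm are
  inherited from the class \<^class>\<open>real_inner\<close>, whose inner product is the real part of \<open>cinner\<close>;
  see \<open>cinner_self\<close>.\<close>

class complex_inner = complex_vector + real_inner +
  fixes cinner :: "'a \<Rightarrow> 'a \<Rightarrow> complex"
  assumes cinner_commute: "cinner x y = cnj (cinner y x)"
    and cinner_add_left: "cinner (x + y) z = cinner x z + cinner y z"
    and cinner_scaleC_left: "cinner (a *\<^sub>C x) y = a * cinner x y"
    and Re_cinner: "Re (cinner x y) = inner x y"

lemma cinner_self: "cinner x x = complex_of_real ((norm x)\<^sup>2)"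
proof (rule complex_eqI)
  have "Im (cinner x x) = - Im (cinner x x)"
    using arg_cong[OF cinner_commute[of x x], of Im] by simp
  then show "Im (cinner x x) = Im (complex_of_real ((norm x)\<^sup>2))"
    by simp
qed (simp add: Re_cinner power2_norm_eq_inner)

class chilbert_space = complex_inner + banach

definition infinite_dim_space :: "'a::chilbert_space itself \<Rightarrow> bool" where
  "infinite_dim_space _ \<longleftrightarrow> (\<nexists>B :: 'a set. finite B \<and> cspan B = UNIV)"


section \<open>Bounded operators\<close>

text \<open>Elements of \<open>\<B>(H)\<close> are functions satisfying \<open>bounded_clinear\<close>; the operator norm is
  \<^const>\<open>onorm\<close>.\<close>

definition bounded_clinear :: "('a::chilbert_space \<Rightarrow> 'a) \<Rightarrow> bool" where
  "bounded_clinear T \<longleftrightarrow> bounded_linear T \<and> (\<forall>c x. T (c *\<^sub>C x) = c *\<^sub>C T x)"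

text \<open>For bounded \<open>T\<close> the operators described in the next two definitions exist and are unique.\<close>

definition cadjoint :: "('a::chilbert_space \<Rightarrow> 'a) \<Rightarrow> 'a \<Rightarrow> 'a" where
  "cadjoint T = (THE S. \<forall>x y. cinner (T x) y = cinner x (S y))"

definition positive_op :: "('a::chilbert_space \<Rightarrow> 'a) \<Rightarrow> bool" where
  "positive_op S \<longleftrightarrow> bounded_clinear S \<and> (\<forall>x. cinner (S x) x \<in> \<real>\<^sub>\<ge>\<^sub>0)"

definition abs_op :: "('a::chilbert_space \<Rightarrow> 'a) \<Rightarrow> 'a \<Rightarrow> 'a" where
  "abs_op T = (THE S. positive_op S \<and> S \<circ> S = cadjoint T \<circ> T)"

definition orth_projection :: "('a::chilbert_space \<Rightarrow> 'a) \<Rightarrow> bool" where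
  "orth_projection P \<longleftrightarrow> bounded_clinear P \<and> P \<circ> P = P \<and> cadjoint P = P"

definition orth_complement :: "'a::chilbert_space set \<Rightarrow> 'a set" where
  "orth_complement M = {x. \<forall>y\<in>M. cinner x y = 0}"

definition partial_isometry :: "('a::chilbert_space \<Rightarrow> 'a) \<Rightarrow> bool" where
  "partial_isometry V \<longleftrightarrow>
     bounded_clinear V \<and> (\<forall>x \<in> orth_complement {z. V z = 0}. norm (V x) = norm x)"

text \<open>\<open>T = \<Sum>\<^sub>i\<^sub>\<in>\<^sub>I F\<^sub>i\<close> in the strong operator topology: pointwise convergence
  of the net of finite partial sums.\<close>

definition has_sum_sot :: "('i \<Rightarrow> 'a::chilbert_space \<Rightarrow> 'a) \<Rightarrow> ('a \<Rightarrow> 'a) \<Rightarrow> 'i set \<Rightarrow> bool" where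
  "has_sum_sot F T I \<longleftrightarrow> (\<forall>x. ((\<lambda>i. F i x) has_sum T x) I)"


section \<open>Reducing subspaces and minimum attaining restrictions\<close>

definition reducing_subspaces :: "('a::chilbert_space \<Rightarrow> 'a) \<Rightarrow> 'a set set" where
  "reducing_subspaces T =
     {M. csubspace M \<and> closed M \<and> T ` M \<subseteq> M \<and> cadjoint T ` M \<subseteq> M}"

text \<open>The restriction \<open>T|\<^sub>M : M \<rightarrow> M\<close> is represented by the pair of \<open>M\<close> and \<open>T\<close>.\<close>

definition min_modulus_on :: "'a::chilbert_space set \<Rightarrow> ('a \<Rightarrow> 'a) \<Rightarrow> real" where
  "min_modulus_on M T = Inf {norm (T x) |x. x \<in> M \<and> norm x = 1}"

definition min_attaining_on :: "'a::chilbert_space set \<Rightarrow> ('a \<Rightarrow> 'a) \<Rightarrow> bool" where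
  "min_attaining_on M T \<longleftrightarrow> (\<exists>x\<^sub>0\<in>M. norm x\<^sub>0 = 1 \<and> norm (T x\<^sub>0) = min_modulus_on M T)"

definition min_attaining_reducing :: "('a::chilbert_space \<Rightarrow> 'a) set" where
  "min_attaining_reducing =
     {T. bounded_clinear T \<and> (\<forall>M \<in> reducing_subspaces T. M \<noteq> {0} \<longrightarrow> min_attaining_on M T)}"

end

theory Submission
  imports Defs
begin

text \<open>Put \<open>A = T\<^sup>* T\<close>. If \<open>T\<close> attains its minimum modulus on a reducing subspace \<open>M\<close> at \<open>x\<close>, then \<open>x\<close> is an
  eigenvector of \<open>A\<close>. The eigenspaces of \<open>A\<close> reduce \<open>|T|\<close>, hence \<open>T\<close> by hypothesis, and so does the double
  orthogonal complement of any union of them; applying minimum attainment there shows that every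
  nonempty set of singular values has a least element. Applied to the orthogonal complement of all
  eigenspaces it shows that they span. With \<open>P\<^sub>l\<close> the projection on the eigenspace for \<open>l\<^sup>2\<close>, take
  \<open>V\<^sub>l = T P\<^sub>l / l\<close>.

  Conversely, on a reducing subspace \<open>M\<close> of \<open>T\<close> only the \<open>P\<^sub>l\<close> with \<open>l\<close> at least some smallest \<open>l\<^sub>0\<close> are
  nonzero, so \<open>l\<^sub>0\<close> is a lower bound for the minimum modulus on \<open>M\<close>. It is attained because the projection
  on \<open>M\<close> of a vector of the \<open>l\<^sub>0\<close>-eigenspace is again an eigenvector.\<close>

section \<open>Orthogonal projections and adjoints\<close>

lemma cinner_scaleC_right: "cinner x (a *\<^sub>C y) = cnj a * cinner x y"
  using cinner_commute[of x "a *\<^sub>C y"] cinner_commute[of x y] by (simp add: cinner_scaleC_left)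

lemma cinner_add_right: "cinner x (y + z) = cinner x y + cinner x z"
  using cinner_commute[of x "y + z"] cinner_commute[of x y] cinner_commute[of x z]
  by (simp add: cinner_add_left)

text \<open>Together with \<open>Re_cinner\<close> this recovers \<open>cinner\<close> from the real
  inner product, so most arguments can be run over the reals.\<close>

lemma Im_cinner: "Im (cinner x y) = inner x (\<i> *\<^sub>C y)"
  by (simp add: Re_cinner[symmetric] cinner_scaleC_right)

lemma cinner_zero_left [simp]: "cinner 0 x = 0"
  using cinner_add_left[of 0 0 x] by simp

lemma cinner_minus_left: "cinner (- x) y = - cinner x y"
  using cinner_add_left[of x "- x" y] by (simp add: eq_neg_iff_add_eq_0 add.commute)

lemma cinner_diff_left: "cinner (x - y) z = cinner x z - cinner y z"
  using cinner_add_left[of x "- y" z] by (simp add: cinner_minus_left)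

lemma scaleC_scaleR: "c *\<^sub>C (r *\<^sub>R x) = r *\<^sub>R (c *\<^sub>C x)"
  by (simp add: scaleC_of_real[symmetric] scaleC_scaleC mult.commute)

lemma csubspace_scaleR: "csubspace M \<Longrightarrow> x \<in> M \<Longrightarrow> r *\<^sub>R x \<in> M"
  by (metis complex_vector.subspace_scale scaleC_of_real)

lemma csubspace_imp_subspace: "csubspace M \<Longrightarrow> subspace M"
  by (simp add: complex_vector.subspace_def csubspace_scaleR real_vector.subspace_def)

text \<open>For small \<open>t\<close> of the sign opposite to \<open>a\<close> the linear term
  dominates. This is the first-variation argument used at every minimiser below.\<close>

lemma quadratic_nonneg_imp_linear_0:
  fixes a b :: real
  assumes "\<And>t. 0 \<le> 2 * t * a + t\<^sup>2 * b"
  shows "a = 0"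
proof (rule ccontr)
  assume "a \<noteq> 0"
  \<comment> \<open>This choice makes \<open>t\<^sup>2 * \<bar>b\<bar>\<close> equal to
    \<open>- t * a - t\<^sup>2\<close>, which cancels half of the linear term.\<close>
  define t where "t = - a / (\<bar>b\<bar> + 1)"
  have t: "t * \<bar>b\<bar> = - a - t" by (simp add: t_def field_simps)
  have "2 * t * a + t\<^sup>2 * b \<le> 2 * t * a + t * (t * \<bar>b\<bar>)"
    by (simp add: power2_eq_square mult.assoc[symmetric] mult_left_mono)
  also have "\<dots> = t * a - t\<^sup>2" unfolding t by (simp add: algebra_simps power2_eq_square)
  also have "\<dots> < 0"
  proof -
    have "0 < a\<^sup>2 / (\<bar>b\<bar> + 1)"
      using \<open>a \<noteq> 0\<close> by (intro divide_pos_pos) auto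
    then have "t * a < 0" by (simp add: t_def power2_eq_square)
    then show ?thesis using zero_le_power2[of t] by linarith
  qed
  finally show False using assms[of t] by simp
qed

text \<open>The representing vector minimises \<open>(norm x)\<^sup>2 - 2 * f x\<close> over \<open>M\<close>; by the parallelogram law
  minimising sequences are Cauchy.\<close>

lemma riesz_on_closed_subspace:
  fixes f :: "'a::{real_inner,banach} \<Rightarrow> real"
  assumes M: "subspace M" "closed M" and f: "bounded_linear f"
  shows "\<exists>u\<in>M. \<forall>v\<in>M. inner u v = f v"
proof -
  interpret f: bounded_linear f by fact
  define q where "q x = (norm x)\<^sup>2 - 2 * f x" for x
  obtain K where K: "\<And>x. norm (f x) \<le> norm x * K" using f.bounded by auto
  have qlow: "- K\<^sup>2 \<le> q x" for x
  proof -
    \<comment> \<open>Completing the square in \<open>(norm x)\<^sup>2 - 2 * K * norm x\<close>,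
      which bounds \<open>q x\<close> from below.\<close>
    have "0 \<le> (norm x - K)\<^sup>2" by simp
    moreover have "f x \<le> norm x * K" using K[of x] by simp
    ultimately show ?thesis by (simp add: q_def power2_diff)
  qed
  define r where "r n = inverse (real (Suc n))" for n
  define d where "d = Inf (q ` M)"
  have bdd: "bdd_below (q ` M)" using qlow by (auto intro!: bdd_belowI)
  have ne: "q ` M \<noteq> {}" using M(1) subspace_0 by blast
  have dle: "d \<le> q x" if "x \<in> M" for x unfolding d_def using that bdd by (intro cInf_lower) auto
  have "\<exists>x\<in>M. q x < d + r n" for n
    using cInf_lessD[OF ne, of "d + r n"] by (force simp: d_def r_def)
  then obtain X where XM: "\<And>n. X n \<in> M" and Xq: "\<And>n. q (X n) < d + r n"
    by metis
  have par: "(norm (x - y))\<^sup>2 \<le> 2 * (q x - d) + 2 * (q y - d)" if "x \<in> M" "y \<in> M" for x y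
  proof -
    have "(1/2) *\<^sub>R (x + y) \<in> M" using M(1) that by (simp add: subspace_add subspace_scale)
    from dle[OF this] have "d \<le> (norm (x + y))\<^sup>2 / 4 - (f x + f y)"
      by (simp add: q_def f.scaleR f.add power_divide add_divide_distrib)
    moreover have "(norm (x + y))\<^sup>2 + (norm (x - y))\<^sup>2 = 2 * (norm x)\<^sup>2 + 2 * (norm y)\<^sup>2"
      by (simp add: power2_norm_eq_inner inner_simps)
    ultimately show ?thesis by (simp add: q_def)
  qed
  have "Cauchy X"
  proof (rule metric_CauchyI)
    fix e :: real assume e: "0 < e"
    obtain N where N: "r N < e\<^sup>2 / 4"
      using reals_Archimedean[of "e\<^sup>2/4"] e by (auto simp: r_def)
    show "\<exists>N. \<forall>m\<ge>N. \<forall>n\<ge>N. dist (X m) (X n) < e"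
    proof (intro exI allI impI)
      fix m n assume mn: "N \<le> m" "N \<le> n"
      have inv: "r m \<le> r N" "r n \<le> r N"
        using mn by (simp_all add: r_def field_simps)
      have "2 * (q (X m) - d) + 2 * (q (X n) - d) < 4 * (e\<^sup>2 / 4)"
        using Xq[of m] Xq[of n] N inv by (smt (verit))
      with par[OF XM XM, of m n] have "(norm (X m - X n))\<^sup>2 < e\<^sup>2" by simp
      then show "dist (X m) (X n) < e" using e by (simp add: dist_norm power_less_imp_less_base)
    qed
  qed
  then obtain u where u: "X \<longlonglongrightarrow> u" using Cauchy_convergent convergent_def by blast
  have uM: "u \<in> M" using M(2) XM u closed_sequentially by blast
  have "(\<lambda>n. q (X n)) \<longlonglongrightarrow> q u" unfolding q_def
    by (intro tendsto_intros u f.tendsto)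
  moreover have "(\<lambda>n. d + r n) \<longlonglongrightarrow> d + 0"
    unfolding r_def by (intro tendsto_intros LIMSEQ_inverse_real_of_nat)
  ultimately have "q u \<le> d"
    using LIMSEQ_le[of "\<lambda>n. q (X n)" "q u" "\<lambda>n. d + r n" "d + 0"] Xq
    by (metis add.right_neutral less_imp_le)
  then have min: "q u \<le> q x" if "x \<in> M" for x using dle[OF that] by simp
  have "inner u v = f v" if v: "v \<in> M" for v
  proof -
    \<comment> \<open>The right-hand side is \<open>q (u + t *\<^sub>R v) - q u\<close>, nonnegative
      because \<open>u\<close> minimises \<open>q\<close> on \<open>M\<close>.\<close>
    have "0 \<le> 2 * t * (inner u v - f v) + t\<^sup>2 * (norm v)\<^sup>2" for t
    proof -
      have "u + t *\<^sub>R v \<in> M" using M(1) uM v by (simp add: subspace_add subspace_scale)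
      from min[OF this] have "(norm u)\<^sup>2 - 2 * f u \<le> (norm (u + t *\<^sub>R v))\<^sup>2 - 2 * f u - 2 * (t * f v)"
        by (simp add: q_def f.add f.scaleR)
      moreover have "(norm (u + t *\<^sub>R v))\<^sup>2 = (norm u)\<^sup>2 + 2 * (t * inner u v) + t\<^sup>2 * (norm v)\<^sup>2"
        unfolding power2_norm_eq_inner
        by (simp add: inner_add_left inner_add_right inner_commute power2_eq_square)
      ultimately show ?thesis by (simp add: algebra_simps)
    qed
    from quadratic_nonneg_imp_linear_0[OF this] show ?thesis by simp
  qed
  with uM show ?thesis by blast
qed

text \<open>The classes tie the norm to complex scalars only through \<open>cinner\<close>; the
  constant \<open>cmod c\<close> comes from expanding
  \<open>cinner (c *\<^sub>C x) (c *\<^sub>C x)\<close>.\<close>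

lemma bounded_linear_scaleC: "bounded_linear (\<lambda>x::'a::complex_inner. c *\<^sub>C x)"
proof (intro bounded_linear_intro[where K="cmod c"])
  fix x :: 'a
  have "cinner (c *\<^sub>C x) (c *\<^sub>C x) = c * cnj c * cinner x x"
    by (simp add: cinner_scaleC_left cinner_scaleC_right)
  also have "\<dots> = complex_of_real ((norm x * cmod c)\<^sup>2)"
    by (simp add: cinner_self complex_norm_square[symmetric] power_mult_distrib)
  finally have "(norm (c *\<^sub>C x))\<^sup>2 = (norm x * cmod c)\<^sup>2" unfolding cinner_self using of_real_eq_iff by blast
  then show "norm (c *\<^sub>C x) \<le> norm x * cmod c" by (rule power2_le_imp_le[OF eq_refl]) simp
qed (simp_all add: scaleC_add_right scaleC_scaleR)

section \<open>Bounded complex-linear operators\<close>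

lemma bounded_clinearD:
  assumes "bounded_clinear T"
  shows "bounded_linear T" "linear T" "T (c *\<^sub>C x) = c *\<^sub>C T x"
  using assms by (auto simp: bounded_clinear_def bounded_linear.linear)

lemma bounded_clinear_compose: "bounded_clinear S \<Longrightarrow> bounded_clinear T \<Longrightarrow> bounded_clinear (\<lambda>x. S (T x))"
  by (auto simp: bounded_clinear_def intro: bounded_linear_compose)

lemma bounded_clinear_add: "bounded_clinear S \<Longrightarrow> bounded_clinear T \<Longrightarrow> bounded_clinear (\<lambda>x. S x + T x)"
  by (auto simp: bounded_clinear_def scaleC_add_right intro: bounded_linear_add)

lemma bounded_clinear_scaleR: "bounded_clinear S \<Longrightarrow> bounded_clinear (\<lambda>x. r *\<^sub>R S x)"
  by (auto simp: bounded_clinear_def scaleC_scaleR intro: bounded_linear_const_scaleR)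

lemma bounded_clinear_ident: "bounded_clinear (\<lambda>x. x)"
  by (auto simp: bounded_clinear_def)

lemma bounded_clinear_diff: "bounded_clinear S \<Longrightarrow> bounded_clinear T \<Longrightarrow> bounded_clinear (\<lambda>x. S x - T x)"
  using bounded_clinear_add[of S "\<lambda>x. (-1) *\<^sub>R T x"] bounded_clinear_scaleR[of T "-1"] by simp

section \<open>Adjoints\<close>

lemma inner_ext: "(\<And>z::'a::real_inner. inner x z = inner y z) \<Longrightarrow> x = y"
  by (metis inner_diff_left inner_eq_zero_iff right_minus_eq)

lemma cinner_ext: "(\<And>z::'a::complex_inner. cinner z x = cinner z y) \<Longrightarrow> x = y"
  by (metis inner_ext Re_cinner inner_commute)

text \<open>Replacing \<open>x\<close> by \<open>\<i> *\<^sub>C x\<close> turns imaginary parts into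
  real ones, and \<open>T\<close> commutes with this replacement.\<close>

lemma cinner_eq_if_inner_eq:
  fixes T S :: "'a::chilbert_space \<Rightarrow> 'a"
  assumes T: "bounded_clinear T" and adj: "\<And>x y. inner (T x) y = inner x (S y)"
  shows "cinner (T x) y = cinner x (S y)"
proof (rule complex_eqI)
  show "Re (cinner (T x) y) = Re (cinner x (S y))" by (simp add: Re_cinner adj)
  have swap: "Im (cinner u v) = - Re (cinner (\<i> *\<^sub>C u) v)" for u v :: 'a
    by (simp add: cinner_scaleC_left)
  show "Im (cinner (T x) y) = Im (cinner x (S y))"
    by (simp only: swap bounded_clinearD(3)[OF T, symmetric] Re_cinner adj)
qed

text \<open>Evaluates the definite description: uniqueness is nondegeneracy of the inner product,
  and the real adjoint relation already gives the complex one.\<close>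

lemma cadjoint_eqI:
  assumes T: "bounded_clinear T" and adj: "\<And>x y. inner (T x) y = inner x (S y)"
  shows "cadjoint T = S"
  unfolding cadjoint_def
proof (rule the_equality)
  show "\<forall>x y. cinner (T x) y = cinner x (S y)" using cinner_eq_if_inner_eq[OF assms] by blast
  fix S' assume "\<forall>x y. cinner (T x) y = cinner x (S' y)"
  then show "S' = S" using cinner_eq_if_inner_eq[OF assms] by (metis cinner_ext ext)
qed

text \<open>Existence of the adjoint is Riesz representation of
  \<open>\<lambda>v. inner (T v) y\<close> on the whole space.\<close>

lemma inner_cadjoint:
  assumes T: "bounded_clinear T"
  shows "inner (T x) y = inner x (cadjoint T y)"
proof -
  have "\<exists>u\<in>UNIV. \<forall>v\<in>UNIV. inner u v = inner (T v) y" for y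
    by (intro riesz_on_closed_subspace bounded_linear_inner_left_comp bounded_clinearD(1)[OF T]) auto
  then obtain S where "\<And>x y. inner (T x) y = inner x (S y)" by (metis UNIV_I inner_commute)
  with cadjoint_eqI[OF T, of S] show ?thesis by simp
qed

lemma cinner_cadjoint:
  "bounded_clinear T \<Longrightarrow> cinner (T x) y = cinner x (cadjoint T y)"
  using cinner_eq_if_inner_eq inner_cadjoint by blast

lemma bounded_clinear_cadjoint:
  assumes T: "bounded_clinear T"
  shows "bounded_clinear (cadjoint T)"
proof -
  note [simp] = cinner_cadjoint[OF T, symmetric]
  have add: "cadjoint T (x + y) = cadjoint T x + cadjoint T y" for x y
    by (rule cinner_ext) (simp add: cinner_add_right)
  have sc: "cadjoint T (c *\<^sub>C x) = c *\<^sub>C cadjoint T x" for c x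
    by (rule cinner_ext) (simp add: cinner_scaleC_right)
  obtain K where K: "\<And>x. norm (T x) \<le> norm x * K" "0 \<le> K"
    using bounded_linear.nonneg_bounded[OF bounded_clinearD(1)[OF T]] by blast
  have "norm (cadjoint T y) \<le> norm y * K" for y
  proof (cases "cadjoint T y = 0")
    case False
    \<comment> \<open>Testing the adjoint relation at \<open>cadjoint T y\<close> itself yields the
      bound \<open>K\<close> of \<open>T\<close> also for the adjoint.\<close>
    have "(norm (cadjoint T y))\<^sup>2 = inner (T (cadjoint T y)) y"
      by (simp add: power2_norm_eq_inner inner_cadjoint[OF T])
    also have "\<dots> \<le> norm (T (cadjoint T y)) * norm y" by (rule norm_cauchy_schwarz)
    also have "\<dots> \<le> norm (cadjoint T y) * K * norm y" using K by (intro mult_right_mono) auto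
    finally show ?thesis using False by (simp add: power2_eq_square mult.assoc mult.commute)
  qed (use K in simp)
  then have "bounded_linear (cadjoint T)"
    by (intro bounded_linear_intro[where K=K]) (auto simp: add, metis sc scaleC_of_real)
  then show ?thesis by (simp add: bounded_clinear_def sc)
qed

lemma cadjoint_self_iff:
  "bounded_clinear S \<Longrightarrow> cadjoint S = S \<longleftrightarrow> (\<forall>x y. inner (S x) y = inner x (S y))"
  by (metis cadjoint_eqI inner_cadjoint)

section \<open>Orthogonal projections onto closed subspaces\<close>

definition proj :: "'a::chilbert_space set \<Rightarrow> 'a \<Rightarrow> 'a" where
  "proj M x = (SOME u. u \<in> M \<and> (\<forall>v\<in>M. inner u v = inner x v))"

context
  fixes M :: "'a::chilbert_space set"
  assumes M: "csubspace M" "closed M"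
begin

text \<open>The projection of \<open>x\<close> is the Riesz vector in \<open>M\<close> of the
  functional \<open>inner x\<close>.\<close>

lemma proj_in: "proj M x \<in> M" and inner_proj: "v \<in> M \<Longrightarrow> inner (proj M x) v = inner x v"
proof -
  have "\<exists>u. u \<in> M \<and> (\<forall>v\<in>M. inner u v = inner x v)"
    using riesz_on_closed_subspace[OF csubspace_imp_subspace[OF M(1)] M(2) bounded_linear_inner_right]
    by blast
  from someI_ex[OF this] show "proj M x \<in> M" "v \<in> M \<Longrightarrow> inner (proj M x) v = inner x v"
    by (auto simp: proj_def)
qed

lemma inner_proj_right: "v \<in> M \<Longrightarrow> inner v (proj M x) = inner v x"
  using inner_proj by (simp add: inner_commute)

lemma proj_unique:
  assumes "u \<in> M" "\<And>v. v \<in> M \<Longrightarrow> inner u v = inner x v"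
  shows "proj M x = u"
proof -
  have "proj M x - u \<in> M" using assms proj_in complex_vector.subspace_diff M(1) by blast
  then have "inner (proj M x - u) (proj M x - u) = 0"
    using assms by (simp add: inner_diff_left inner_proj)
  then show ?thesis by simp
qed

lemma proj_fixed: "x \<in> M \<Longrightarrow> proj M x = x"
  by (rule proj_unique) auto

lemma norm_proj_le: "norm (proj M x) \<le> norm x"
proof -
  have "norm (proj M x) * norm (proj M x) = inner x (proj M x)"
    using inner_proj[OF proj_in] by (simp add: power2_norm_eq_inner power2_eq_square[symmetric])
  also have "\<dots> \<le> norm x * norm (proj M x)" by (rule norm_cauchy_schwarz)
  finally show ?thesis by (cases "proj M x = 0") auto
qed

lemma inner_proj_sym: "inner (proj M x) y = inner x (proj M y)"
  by (metis inner_commute inner_proj proj_in)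

text \<open>\<open>M\<close> is closed under multiplication by \<open>\<i>\<close>, so real
  orthogonality to \<open>M\<close> is complex orthogonality. This gives complex homogeneity of
  \<open>proj M\<close> below.\<close>

lemma cinner_diff_proj: "v \<in> M \<Longrightarrow> cinner (x - proj M x) v = 0"
  by (rule complex_eqI)
    (simp_all add: Re_cinner Im_cinner inner_diff_left inner_proj complex_vector.subspace_scale[OF M(1)])

lemma bounded_clinear_proj: "bounded_clinear (proj M)"
proof -
  have add: "proj M (x + y) = proj M x + proj M y" for x y
    by (rule proj_unique) (auto simp: inner_add_left inner_proj proj_in complex_vector.subspace_add[OF M(1)])
  have sc: "proj M (c *\<^sub>C x) = c *\<^sub>C proj M x" for c x
  proof (rule proj_unique)
    show "c *\<^sub>C proj M x \<in> M" using complex_vector.subspace_scale[OF M(1)] proj_in by blast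
    fix v assume "v \<in> M"
    from cinner_diff_proj[OF this, of x] show "inner (c *\<^sub>C proj M x) v = inner (c *\<^sub>C x) v"
      by (simp add: Re_cinner[symmetric] cinner_scaleC_left cinner_diff_left)
  qed
  have "bounded_linear (proj M)"
    by (intro bounded_linear_intro[where K=1]) (auto simp: add norm_proj_le, metis sc scaleC_of_real)
  then show ?thesis by (simp add: bounded_clinear_def sc)
qed

lemma orth_projection_proj: "orth_projection (proj M)"
  using bounded_clinear_proj cadjoint_eqI[OF bounded_clinear_proj inner_proj_sym]
  by (simp add: orth_projection_def fun_eq_iff proj_fixed proj_in)

end

section \<open>The modulus of an operator\<close>

lemma positive_op_inner_sym:
  assumes "positive_op S"
  shows "inner (S x) y = inner x (S y)"
proof -
  have S: "bounded_clinear S" and re: "\<And>x. cinner (S x) x \<in> \<real>\<^sub>\<ge>\<^sub>0"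
    using assms by (auto simp: positive_op_def)
  interpret S: bounded_linear S using S by (rule bounded_clinearD)
  \<comment> \<open>Polarisation: \<open>h\<close> measures the failure of symmetry and vanishes on
    the diagonal because \<open>cinner (S x) x\<close> is real. Testing at \<open>x + y\<close> and
    \<open>x + \<i> *\<^sub>C y\<close> then makes it vanish everywhere.\<close>
  define h where "h x y = cinner (S x) y - cinner x (S y)" for x y
  have h0: "h x x = 0" for x
    using re[of x] cinner_commute[of x "S x"] by (auto simp: h_def nonneg_Reals_def Reals_cnj_iff)
  have 1: "h x y + h y x = 0" for x y
  proof -
    have "h (x + y) (x + y) = h x x + h y y + (h x y + h y x)"
      by (simp add: h_def S.add cinner_add_left cinner_add_right)
    then show ?thesis by (simp add: h0)
  qed
  have "h x (\<i> *\<^sub>C y) = - \<i> * h x y" "h (\<i> *\<^sub>C y) x = \<i> * h y x" 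
    by (simp_all add: h_def bounded_clinearD(3)[OF S] cinner_scaleC_left cinner_scaleC_right algebra_simps)
  with 1[of x "\<i> *\<^sub>C y"] have "\<i> * (h y x - h x y) = 0" by (simp add: algebra_simps)
  with 1[of x y] have "h x y = 0" by simp
  then have "Re (h x y) = 0" by simp
  then show ?thesis by (simp add: h_def Re_cinner)
qed

text \<open>The working form over the real inner product. Symmetry is listed separately because a
  nonnegative real quadratic form does not imply it.\<close>

lemma positive_op_iff:
  "positive_op S \<longleftrightarrow> bounded_clinear S \<and> (\<forall>x y. inner (S x) y = inner x (S y)) \<and> (\<forall>x. 0 \<le> inner (S x) x)"
    (is "_ \<longleftrightarrow> ?R")
proof
  assume S: "positive_op S"
  have "0 \<le> inner (S x) x" for x
    using S by (simp add: positive_op_def Re_cinner[symmetric] complex_nonneg_Reals_iff)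
  with S positive_op_inner_sym show ?R by (auto simp: positive_op_def)
next
  assume R: ?R
  have "cinner (S x) x \<in> \<real>\<^sub>\<ge>\<^sub>0" for x
  proof -
    have "cinner (S x) x = cnj (cinner (S x) x)"
      using cinner_eq_if_inner_eq[of S S x x] R cinner_commute[of "S x" x] by auto
    then have "Im (cinner (S x) x) = 0" by (simp add: complex_eq_iff)
    moreover have "0 \<le> inner (S x) x" using R by blast
    ultimately show ?thesis by (simp add: complex_nonneg_Reals_iff Re_cinner)
  qed
  with R show "positive_op S" by (simp add: positive_op_def)
qed

text \<open>The form of \<open>S\<close> takes its minimum 0 at \<open>y\<close>, so its derivative
  there in the direction \<open>S y\<close>, twice the squared norm of \<open>S y\<close>, is
  zero.\<close>

lemma positive_op_eq_0:
  assumes S: "positive_op S" and 0: "inner (S y) y = 0"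
  shows "S y = 0"
proof -
  have R: "bounded_clinear S" "\<And>x y. inner (S x) y = inner x (S y)" "\<And>x. 0 \<le> inner (S x) x"
    using S positive_op_iff by auto
  interpret S: bounded_linear S using R(1) by (rule bounded_clinearD)
  have "0 \<le> 2 * t * inner (S y) (S y) + t\<^sup>2 * inner (S (S y)) (S y)" for t
  proof -
    have "0 \<le> inner (S (y + t *\<^sub>R S y)) (y + t *\<^sub>R S y)" by (rule R)
    also have "\<dots> = 2 * t * inner (S y) (S y) + t\<^sup>2 * inner (S (S y)) (S y)"
      using 0 by (simp add: S.add S.scaleR inner_add_left inner_add_right R(2)[of "S y" y]
          power2_eq_square algebra_simps)
    finally show ?thesis .
  qed
  from quadratic_nonneg_imp_linear_0[OF this] show ?thesis by simp
qed

section \<open>Real polynomials of an operator, evaluated by Horner's scheme\<close>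

definition op_poly :: "real poly \<Rightarrow> ('a::real_vector \<Rightarrow> 'a) \<Rightarrow> 'a \<Rightarrow> 'a" where
  "op_poly p S = fold_coeffs (\<lambda>a f x. a *\<^sub>R x + S (f x)) p (\<lambda>x. 0)"

lemma op_poly_0 [simp]: "op_poly 0 S = (\<lambda>x. 0)"
  by (simp add: op_poly_def)

context
  fixes S :: "'a::chilbert_space \<Rightarrow> 'a"
  assumes S: "bounded_clinear S"
begin

interpretation S: bounded_linear S using S by (rule bounded_clinearD)

lemma op_poly_pCons [simp]: "op_poly (pCons a p) S x = a *\<^sub>R x + S (op_poly p S x)"
  by (cases "a = 0 \<and> p = 0") (auto simp: op_poly_def S.zero)

lemma op_poly_add: "op_poly (p + q) S x = op_poly p S x + op_poly q S x"
  by (induction p q rule: poly_induct2) (auto simp: S.add algebra_simps)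

lemma op_poly_smult: "op_poly (smult a p) S x = a *\<^sub>R op_poly p S x"
  by (induction p) (auto simp: S.scaleR algebra_simps)

lemma bounded_clinear_op_poly: "bounded_clinear (op_poly p S)"
proof (induction p)
  case 0
  then show ?case using bounded_clinear_scaleR[OF bounded_clinear_ident, of 0] by simp
next
  case (pCons a p)
  have "bounded_clinear (\<lambda>x. a *\<^sub>R x + S (op_poly p S x))"
    by (intro bounded_clinear_add bounded_clinear_scaleR bounded_clinear_ident bounded_clinear_compose[OF S] pCons)
  moreover have "op_poly (pCons a p) S = (\<lambda>x. a *\<^sub>R x + S (op_poly p S x))" by auto
  ultimately show ?case by simp
qed

lemma op_poly_mult: "op_poly (p * q) S x = op_poly p S (op_poly q S x)"
  by (induction p) (auto simp: op_poly_add op_poly_smult)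

lemma op_poly_commute:
  assumes B: "bounded_linear B" and BS: "\<And>x. B (S x) = S (B x)"
  shows "op_poly p S (B x) = B (op_poly p S x)"
proof -
  interpret B: bounded_linear B by fact
  show ?thesis by (induction p) (auto simp: B.zero B.add B.scaleR BS)
qed

lemma op_poly_sym:
  assumes "\<And>x y. inner (S x) y = inner x (S y)"
  shows "inner (op_poly p S x) y = inner x (op_poly p S y)"
proof (induction p arbitrary: x y)
  case (pCons a p)
  then show ?case
    using op_poly_commute[OF S.bounded_linear_axioms, of p]
    by (simp add: inner_simps assms)
qed auto

text \<open>Powers of a contraction are contractions, so the norm of \<open>p(S)\<close> is at most
  the sum of the coefficients, which is \<open>poly p 1\<close>.\<close>

lemma norm_op_poly_le:
  assumes "\<And>x. norm (S x) \<le> norm x" and "\<And>i. 0 \<le> coeff p i"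
  shows "norm (op_poly p S x) \<le> poly p 1 * norm x"
  using assms(2)
proof (induction p)
  case (pCons a p)
  have a: "0 \<le> a" using pCons.prems[of 0] by simp
  have "norm (op_poly p S x) \<le> poly p 1 * norm x"
    using pCons.prems[of "Suc _"] by (intro pCons.IH) simp
  then have "norm (S (op_poly p S x)) \<le> poly p 1 * norm x" using assms(1) order_trans by blast
  then have "norm (a *\<^sub>R x + S (op_poly p S x)) \<le> a * norm x + poly p 1 * norm x"
    using a by (intro norm_triangle_le) simp
  then show ?case by (simp add: algebra_simps)
qed auto

end


section \<open>Polynomial iterates for the function \<open>1 - sqrt (1 - x)\<close>\<close>

fun sqrt_poly :: "nat \<Rightarrow> real poly" where
  "sqrt_poly 0 = 0"
| "sqrt_poly (Suc n) = smult (1/2) ([:0, 1:] + sqrt_poly n * sqrt_poly n)"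

definition nonneg_poly :: "real poly \<Rightarrow> bool" where
  "nonneg_poly p \<longleftrightarrow> (\<forall>i. 0 \<le> coeff p i)"

lemma nonneg_poly_add: "nonneg_poly p \<Longrightarrow> nonneg_poly q \<Longrightarrow> nonneg_poly (p + q)"
  by (simp add: nonneg_poly_def)

lemma nonneg_poly_mult: "nonneg_poly p \<Longrightarrow> nonneg_poly q \<Longrightarrow> nonneg_poly (p * q)"
  by (simp add: nonneg_poly_def coeff_mult sum_nonneg)

lemma nonneg_poly_smult: "0 \<le> a \<Longrightarrow> nonneg_poly p \<Longrightarrow> nonneg_poly (smult a p)"
  by (simp add: nonneg_poly_def)

lemma nonneg_sqrt_poly: "nonneg_poly (sqrt_poly n)"
proof (induction n)
  case (Suc n)
  have "nonneg_poly [:0, 1:]" by (simp add: nonneg_poly_def coeff_pCons split: nat.split)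
  with Suc show ?case by (simp only: sqrt_poly.simps) (intro nonneg_poly_smult nonneg_poly_add nonneg_poly_mult, auto)
qed (simp add: nonneg_poly_def)

text \<open>The recursion factors each difference as half the previous difference times the sum of
  the two previous iterates, so nonnegativity propagates.\<close>

lemma nonneg_sqrt_poly_Suc_diff: "nonneg_poly (sqrt_poly (Suc n) - sqrt_poly n)"
proof (induction n)
  case 0
  then show ?case by (simp add: nonneg_poly_def coeff_pCons split: nat.split)
next
  case (Suc n)
  have "sqrt_poly (Suc (Suc n)) - sqrt_poly (Suc n)
      = smult (1/2) ((sqrt_poly (Suc n) - sqrt_poly n) * (sqrt_poly (Suc n) + sqrt_poly n))"
    by (subst (1) sqrt_poly.simps(2), subst (3) sqrt_poly.simps(2))
      (simp add: algebra_simps smult_diff_right[symmetric] del: sqrt_poly.simps)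
  then show ?case
    using Suc nonneg_sqrt_poly
    by (simp only:) (intro nonneg_poly_smult nonneg_poly_add nonneg_poly_mult, auto simp del: sqrt_poly.simps)
qed

lemma nonneg_sqrt_poly_diff:
  assumes "m \<le> n"
  shows "nonneg_poly (sqrt_poly n - sqrt_poly m)"
  using assms
proof (induction n rule: dec_induct)
  case base
  then show ?case by (simp add: nonneg_poly_def)
next
  case (step n)
  with nonneg_poly_add[OF step.IH nonneg_sqrt_poly_Suc_diff[of n]] show ?case by simp
qed

lemma sqrt_poly_1_le: "poly (sqrt_poly n) 1 \<le> 1"
proof -
  have "0 \<le> poly (sqrt_poly n) 1 \<and> poly (sqrt_poly n) 1 \<le> 1"
    by (induction n) (auto intro: mult_le_one)
  then show ?thesis ..
qed

lemma poly_1_nonneg: "nonneg_poly p \<Longrightarrow> 0 \<le> poly p 1"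
  by (simp add: nonneg_poly_def poly_altdef sum_nonneg)

text \<open>\<open>Y\<close> is the limit of \<open>Y\<^sub>n\<^sub>+\<^sub>1 = (S + Y\<^sub>n\<^sup>2) / 2\<close>. The differences of these iterates are polynomials in \<open>S\<close>
  with nonnegative coefficients, so their norms are bounded by the values of the polynomials at 1.\<close>

lemma sqrt_iteration_limit:
  fixes S :: "'a::chilbert_space \<Rightarrow> 'a"
  assumes S: "bounded_clinear S" and contr: "\<And>x. norm (S x) \<le> norm x"
    and sym: "\<And>x y. inner (S x) y = inner x (S y)"
  obtains Y where "bounded_clinear Y" "\<And>x. norm (Y x) \<le> norm x"
    "\<And>x y. inner (Y x) y = inner x (Y y)" "\<And>x. 2 *\<^sub>R Y x = S x + Y (Y x)"
    "\<And>B x. bounded_linear B \<Longrightarrow> (\<And>z. B (S z) = S (B z)) \<Longrightarrow> Y (B x) = B (Y x)"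
proof -
  define y where "y n = poly (sqrt_poly n) 1" for n
  define Z where "Z n = op_poly (sqrt_poly n) S" for n
  define Y where "Y x = lim (\<lambda>n. Z n x)" for x
  have Zlin: "bounded_clinear (Z n)" for n unfolding Z_def by (rule bounded_clinear_op_poly[OF S])
  have Zdiff: "norm (Z n x - Z m x) \<le> (y n - y m) * norm x" if "m \<le> n" for m n x
  proof -
    have "Z n x = op_poly (sqrt_poly n - sqrt_poly m) S x + Z m x"
      by (simp add: Z_def op_poly_add[OF S, symmetric])
    with norm_op_poly_le[OF S contr, of "sqrt_poly n - sqrt_poly m" x] nonneg_sqrt_poly_diff[OF that]
    show ?thesis by (simp add: y_def nonneg_poly_def)
  qed
  have Zle: "norm (Z n x) \<le> norm x" for n x
  proof -
    have "norm (Z n x) \<le> y n * norm x"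
      using norm_op_poly_le[OF S contr] nonneg_sqrt_poly by (simp add: Z_def y_def nonneg_poly_def)
    also have "\<dots> \<le> 1 * norm x" using sqrt_poly_1_le by (intro mult_right_mono) (auto simp: y_def)
    finally show ?thesis by simp
  qed
  \<comment> \<open>Operator convergence is reduced to the real sequence \<open>y\<close>, which is
    increasing and bounded by 1, hence Cauchy.\<close>
  have "incseq y"
    using poly_1_nonneg[OF nonneg_sqrt_poly_diff] by (intro monoI) (simp add: y_def)
  then have "Cauchy y"
    using sqrt_poly_1_le[folded y_def] by (metis incseq_convergent convergentI LIMSEQ_imp_Cauchy)
  have "Cauchy (\<lambda>n. Z n x)" for x
  proof (rule metric_CauchyI)
    fix e :: real assume "0 < e"
    \<comment> \<open>The summand 1 avoids division by zero at \<open>x = 0\<close>.\<close>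
    then have "0 < e / (norm x + 1)" by (simp add: add_nonneg_pos)
    from metric_CauchyD[OF \<open>Cauchy y\<close> this] obtain N
      where N: "\<And>m n. m \<ge> N \<Longrightarrow> n \<ge> N \<Longrightarrow> \<bar>y m - y n\<bar> < e / (norm x + 1)"
      by (auto simp: dist_real_def)
    have *: "norm (Z n x - Z m x) < e" if "N \<le> m" "m \<le> n" for m n
    proof -
      have "norm (Z n x - Z m x) \<le> \<bar>y n - y m\<bar> * (norm x + 1)"
        using Zdiff[OF that(2), of x] by (rule order_trans) (intro mult_mono, auto)
      also have "\<dots> < e"
        using N[of n m] that by (simp add: pos_less_divide_eq add_nonneg_pos)
      finally show ?thesis .
    qed
    show "\<exists>N. \<forall>m\<ge>N. \<forall>n\<ge>N. dist (Z m x) (Z n x) < e"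
      by (metis * dist_commute dist_norm nle_le)
  qed
  then have Y: "(\<lambda>n. Z n x) \<longlonglongrightarrow> Y x" for x
    unfolding Y_def using Cauchy_convergent convergent_LIMSEQ_iff by blast
  have Yle: "norm (Y x) \<le> norm x" for x
    using Lim_bounded[OF tendsto_norm[OF Y]] Zle by blast
  have Yadd: "Y (a + b) = Y a + Y b" for a b
    using Y[of "a + b"] tendsto_add[OF Y[of a] Y[of b]] linear_add[OF bounded_clinearD(2)[OF Zlin]]
      LIMSEQ_unique by (metis (no_types, lifting) ext)
  have comm: "Y (B x) = B (Y x)" if "bounded_linear B" "\<And>z. B (S z) = S (B z)" for B x
  proof -
    have "(\<lambda>n. Z n (B x)) \<longlonglongrightarrow> B (Y x)"
      using bounded_linear.tendsto[OF that(1) Y] by (simp add: Z_def op_poly_commute[OF S that])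
    with Y[of "B x"] show ?thesis using LIMSEQ_unique by blast
  qed
  \<comment> \<open>Complex homogeneity is commutation with the operator of multiplication by
    \<open>c\<close>.\<close>
  have Ysc: "Y (c *\<^sub>C x) = c *\<^sub>C Y x" for c x
    using comm[OF bounded_linear_scaleC] bounded_clinearD(3)[OF S] by simp
  have "bounded_linear Y"
    by (intro bounded_linear_intro[where K=1]) (auto simp: Yadd Yle, metis Ysc scaleC_of_real)
  then have Ylin: "bounded_clinear Y" by (simp add: bounded_clinear_def Ysc)
  have Ysym: "inner (Y a) b = inner a (Y b)" for a b
  proof -
    have "(\<lambda>n. inner (Z n a) b) \<longlonglongrightarrow> inner (Y a) b" by (intro tendsto_intros Y)
    moreover have "(\<lambda>n. inner (Z n a) b) \<longlonglongrightarrow> inner a (Y b)"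
      unfolding Z_def op_poly_sym[OF S sym] by (intro tendsto_intros Y[unfolded Z_def])
    ultimately show ?thesis using LIMSEQ_unique by blast
  qed
  have Yeq: "2 *\<^sub>R Y x = S x + Y (Y x)" for x
  proof -
    \<comment> \<open>All \<open>Z n\<close> are contractions, so the inner argument may be replaced
      by its limit before the outer one converges.\<close>
    have "(\<lambda>n. Z n (Z n x - Y x)) \<longlonglongrightarrow> 0"
      by (rule Lim_null_comparison[OF _ tendsto_norm_zero[OF LIM_zero[OF Y[of x]]]]) (simp add: Zle)
    from tendsto_add[OF this Y[of "Y x"]] have "(\<lambda>n. Z n (Z n x)) \<longlonglongrightarrow> Y (Y x)"
      by (simp add: linear_diff[OF bounded_clinearD(2)[OF Zlin]])
    then have "(\<lambda>n. S x + Z n (Z n x)) \<longlonglongrightarrow> S x + Y (Y x)" by (intro tendsto_intros)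
    moreover have "S x + Z n (Z n x) = 2 *\<^sub>R Z (Suc n) x" for n
      by (simp add: Z_def op_poly_smult[OF S] op_poly_add[OF S] op_poly_mult[OF S] op_poly_pCons[OF S]
          linear_0[OF bounded_clinearD(2)[OF S]])
    ultimately have "(\<lambda>n. 2 *\<^sub>R Z (Suc n) x) \<longlonglongrightarrow> S x + Y (Y x)" by simp
    moreover have "(\<lambda>n. 2 *\<^sub>R Z (Suc n) x) \<longlonglongrightarrow> 2 *\<^sub>R Y x"
      using LIMSEQ_Suc[OF Y[of x]] by (intro tendsto_intros)
    ultimately show ?thesis using LIMSEQ_unique by blast
  qed
  show thesis by (rule that[OF Ylin Yle Ysym Yeq comm])
qed

section \<open>The positive square root\<close>

lemma positive_sqrt_unique:
  assumes Q: "positive_op Q" and R: "positive_op R"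
    and eq: "\<And>x. Q (Q x) = R (R x)" and comm: "\<And>x. Q (R x) = R (Q x)"
  shows "Q = R"
proof
  fix x
  have bl: "bounded_clinear Q" "bounded_clinear R" using Q R by (auto simp: positive_op_def)
  interpret Q: bounded_linear Q using bl(1) by (rule bounded_clinearD)
  interpret R: bounded_linear R using bl(2) by (rule bounded_clinearD)
  define y where "y = Q x - R x"
  \<comment> \<open>By commutation, \<open>(Q + R) (Q - R) x\<close> is
    \<open>Q (Q x) - R (R x)\<close>. Both forms then vanish at \<open>y\<close>, so
    \<open>Q\<close> and \<open>R\<close> kill \<open>y\<close>, and symmetry makes \<open>y\<close>
    orthogonal to itself.\<close>
  have "Q y + R y = 0" by (simp add: y_def Q.diff R.diff eq comm)
  then have "inner (Q y) y + inner (R y) y = 0" by (metis inner_add_left inner_zero_left)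
  moreover have "inner (Q y) y \<ge> 0" "inner (R y) y \<ge> 0" using Q R by (auto simp: positive_op_iff)
  ultimately have "Q y = 0" "R y = 0"
    using positive_op_eq_0[OF Q, of y] positive_op_eq_0[OF R, of y] by auto
  then have "inner y y = 0"
    using positive_op_inner_sym[OF Q, of x y] positive_op_inner_sym[OF R, of x y]
    by (subst (1) y_def) (simp add: inner_diff_left)
  then show "Q x = R x" by (simp add: y_def)
qed

text \<open>With \<open>S = 1 - A / c\<^sup>2\<close> the iteration limit \<open>Y\<close> plays the
  role of \<open>1 - sqrt (1 - S)\<close>, so \<open>c (1 - Y)\<close> is a positive root of
  \<open>A\<close>. Any other positive root commutes with \<open>A\<close>, hence with
  \<open>S\<close>, \<open>Y\<close> and this root, and uniqueness for commuting roots
  applies.\<close>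

lemma
  assumes T: "bounded_clinear T"
  shows positive_abs_op: "positive_op (abs_op T)"
    and abs_op_abs_op: "abs_op T (abs_op T x) = cadjoint T (T x)"
proof -
  define A where "A x = cadjoint T (T x)" for x
  have A: "bounded_clinear A"
    unfolding A_def[abs_def] by (rule bounded_clinear_compose[OF bounded_clinear_cadjoint[OF T] T])
  interpret A: bounded_linear A using A by (rule bounded_clinearD)
  have AT: "inner x (A y) = inner (T x) (T y)" for x y
    by (simp add: A_def inner_cadjoint[OF T])
  have AT': "inner (A x) y = inner (T x) (T y)" for x y
    using AT[of y x] by (simp add: inner_commute)
  obtain c where c: "c > 0" "\<And>x. norm (T x) \<le> norm x * c"
    using bounded_linear.pos_bounded[OF bounded_clinearD(1)[OF T]] by blast
  define S where "S x = x - (1 / c\<^sup>2) *\<^sub>R A x" for x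
  have S: "bounded_clinear S"
    unfolding S_def[abs_def] by (intro bounded_clinear_diff bounded_clinear_scaleR bounded_clinear_ident A)
  have Ssym: "inner (S x) y = inner x (S y)" for x y
    by (simp add: S_def inner_simps AT AT')
  have "norm (S x) \<le> norm x" for x
  proof -
    define r where "r = 1 / c\<^sup>2"
    \<comment> \<open>Bounding by \<open>norm (T x)\<close> rather than \<open>norm x\<close> lets
      the cross term in the expansion of \<open>(norm (S x))\<^sup>2\<close> absorb the term in
      \<open>(norm (A x))\<^sup>2\<close>.\<close>
    have "norm (A x) \<le> c * norm (T x)"
    proof (cases "A x = 0")
      case False
      have "norm (A x) * norm (A x) = inner (T (A x)) (T x)"
        by (simp add: AT[symmetric] power2_norm_eq_inner power2_eq_square[symmetric])
      also have "\<dots> \<le> norm (T (A x)) * norm (T x)" by (rule norm_cauchy_schwarz)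
      also have "\<dots> \<le> norm (A x) * c * norm (T x)" using c by (intro mult_right_mono) auto
      finally show ?thesis using False by (simp add: mult.assoc)
    qed (use c in simp)
    then have "(norm (A x))\<^sup>2 \<le> (c * norm (T x))\<^sup>2" by (intro power_mono) auto
    then have le: "(norm (A x))\<^sup>2 \<le> c\<^sup>2 * (norm (T x))\<^sup>2" by (simp add: power_mult_distrib)
    have "r\<^sup>2 * (norm (A x))\<^sup>2 \<le> r * (norm (T x))\<^sup>2"
      using mult_left_mono[OF le, of "r\<^sup>2"] c by (simp add: r_def power2_eq_square)
    moreover have "(norm (S x))\<^sup>2 = (norm x)\<^sup>2 - 2 * (r * (norm (T x))\<^sup>2) + r\<^sup>2 * (norm (A x))\<^sup>2"
      unfolding power2_norm_eq_inner S_def r_def[symmetric]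
      by (simp add: inner_diff_left inner_diff_right AT[of x x] AT'[of x x] power2_eq_square algebra_simps)
    moreover have "0 \<le> r * (norm (T x))\<^sup>2" by (simp add: r_def)
    ultimately have "(norm (S x))\<^sup>2 \<le> (norm x)\<^sup>2" by linarith
    then show ?thesis by (rule power2_le_imp_le) simp
  qed
  from sqrt_iteration_limit[OF S this Ssym]
  obtain Y where Y: "bounded_clinear Y" "\<And>x. norm (Y x) \<le> norm x"
    "\<And>x y. inner (Y x) y = inner x (Y y)" "\<And>x. 2 *\<^sub>R Y x = S x + Y (Y x)"
    "\<And>B x. bounded_linear B \<Longrightarrow> (\<And>z. B (S z) = S (B z)) \<Longrightarrow> Y (B x) = B (Y x)"
    by blast
  interpret Y: bounded_linear Y using Y(1) by (rule bounded_clinearD)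
  define Q where "Q x = c *\<^sub>R (x - Y x)" for x
  have Qlin: "bounded_clinear Q"
    unfolding Q_def[abs_def] by (intro bounded_clinear_scaleR bounded_clinear_diff bounded_clinear_ident Y)
  have "inner (Y x) x \<le> inner x x" for x
  proof -
    have "inner (Y x) x \<le> norm (Y x) * norm x" by (rule norm_cauchy_schwarz)
    also have "\<dots> \<le> norm x * norm x" by (intro mult_right_mono Y) simp
    finally show ?thesis by (simp add: power2_norm_eq_inner[symmetric] power2_eq_square)
  qed
  then have Q: "positive_op Q"
    using Qlin c by (auto simp: positive_op_iff Q_def inner_simps Y(3))
  have QQ: "Q (Q x) = A x" for x
  proof -
    \<comment> \<open>The fixed-point equation for \<open>Y\<close> reduces the bracket to
      \<open>x - S x\<close>.\<close>
    have "Q (Q x) = c\<^sup>2 *\<^sub>R (x - 2 *\<^sub>R Y x + Y (Y x))"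
      by (simp add: Q_def Y.scaleR Y.diff scaleR_2 power2_eq_square algebra_simps)
    also have "\<dots> = A x" using c by (simp add: Y(4) S_def)
    finally show ?thesis .
  qed
  have "\<exists>!S. positive_op S \<and> S \<circ> S = cadjoint T \<circ> T"
  proof (rule ex1I[of _ Q])
    show "positive_op Q \<and> Q \<circ> Q = cadjoint T \<circ> T" using Q QQ by (auto simp: A_def fun_eq_iff)
    fix R assume R: "positive_op R \<and> R \<circ> R = cadjoint T \<circ> T"
    then have RR: "R (R x) = A x" for x by (metis A_def comp_apply)
    have Rl: "bounded_linear R" using R positive_op_def bounded_clinearD(1) by blast
    interpret R: bounded_linear R by (rule Rl)
    have "R (S z) = S (R z)" for z by (simp add: S_def R.diff R.scaleR RR[symmetric])
    then have "Y (R x) = R (Y x)" for x by (rule Y(5)[OF Rl])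
    then have "Q (R x) = R (Q x)" for x by (simp add: Q_def R.scaleR R.diff)
    with positive_sqrt_unique[OF Q, of R] R show "R = Q" by (simp add: QQ RR)
  qed
  from theI'[OF this] have "positive_op (abs_op T) \<and> abs_op T \<circ> abs_op T = cadjoint T \<circ> T"
    by (simp add: abs_op_def)
  then show "positive_op (abs_op T)" "abs_op T (abs_op T x) = cadjoint T (T x)"
    by (auto simp: fun_eq_iff)
qed

section \<open>Reducing subspaces and minimal vectors\<close>

lemma mem_reducing_subspaces:
  "M \<in> reducing_subspaces T \<longleftrightarrow>
    csubspace M \<and> closed M \<and> (\<forall>x\<in>M. T x \<in> M) \<and> (\<forall>x\<in>M. cadjoint T x \<in> M)"
  by (auto simp: reducing_subspaces_def)

text \<open>Testing against \<open>\<i> *\<^sub>C v\<close>, which also lies in \<open>M\<close>,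
  removes the imaginary part.\<close>

lemma orth_complement_csubspaceI:
  assumes M: "csubspace M" and "\<And>v. v \<in> M \<Longrightarrow> inner w v = 0"
  shows "w \<in> orth_complement M"
proof -
  have "cinner w v = 0" if "v \<in> M" for v
    using assms(2)[OF that] assms(2)[OF complex_vector.subspace_scale[OF M that, of \<i>]]
    by (simp add: complex_eq_iff Re_cinner Im_cinner)
  then show ?thesis by (simp add: orth_complement_def)
qed

text \<open>Moving \<open>T\<close> across the inner product exchanges it with its adjoint.
  \<open>X\<close> is an arbitrary invariant set so that unions of eigenspaces are covered.\<close>

lemma orth_complement_reducing:
  assumes T: "bounded_clinear T"
    and TX: "\<And>x. x \<in> X \<Longrightarrow> T x \<in> X" and adj: "\<And>x. x \<in> X \<Longrightarrow> cadjoint T x \<in> X"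
  shows "orth_complement X \<in> reducing_subspaces T"
  unfolding mem_reducing_subspaces
proof (intro conjI ballI)
  show "csubspace (orth_complement X)"
    by (auto simp: complex_vector.subspace_def orth_complement_def cinner_add_left cinner_scaleC_left)
  have "orth_complement X = (\<Inter>y\<in>X. {x. inner x y = 0} \<inter> {x. inner x (\<i> *\<^sub>C y) = 0})"
    by (auto simp: orth_complement_def complex_eq_iff Re_cinner Im_cinner)
  also have "closed \<dots>"
    by (intro closed_INT ballI closed_Int closed_Collect_eq continuous_intros)
  finally show "closed (orth_complement X)" .
  fix x assume x: "x \<in> orth_complement X"
  then show "T x \<in> orth_complement X"
    by (auto simp: orth_complement_def cinner_cadjoint[OF T] adj)
  have "cinner (cadjoint T x) y = 0" if "y \<in> X" for y
    using x TX[OF that] cinner_commute[of "cadjoint T x" y] cinner_commute[of "T y" x]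
    by (simp add: cinner_cadjoint[OF T, symmetric] orth_complement_def)
  then show "cadjoint T x \<in> orth_complement X" by (simp add: orth_complement_def)
qed

section \<open>Vectors attaining the minimum modulus\<close>

lemma min_attaining_onI:
  assumes x: "x \<in> M" "norm x = 1" and min: "\<And>y. y \<in> M \<Longrightarrow> norm (T x) * norm y \<le> norm (T y)"
  shows "min_attaining_on M T"
proof -
  have "Inf {norm (T y) |y. y \<in> M \<and> norm y = 1} = norm (T x)"
    using x min by (intro cInf_eq_minimum) fastforce+
  with x show ?thesis by (auto simp: min_attaining_on_def min_modulus_on_def)
qed

text \<open>With \<open>\<mu> = norm (T x)\<close>, the function
  \<open>(norm (T y))\<^sup>2 - \<mu>\<^sup>2 * (norm y)\<^sup>2\<close> is nonnegative on
  \<open>M\<close> and zero at \<open>x\<close>; its vanishing first variation is the eigenvalue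
  equation.\<close>

lemma min_attaining_onD:
  assumes T: "bounded_clinear T" and M: "M \<in> reducing_subspaces T" and att: "min_attaining_on M T"
  obtains x where "x \<in> M" "norm x = 1" "cadjoint T (T x) = (norm (T x))\<^sup>2 *\<^sub>R x"
    "\<And>y. y \<in> M \<Longrightarrow> norm (T x) * norm y \<le> norm (T y)"
proof -
  interpret T: bounded_linear T using T by (rule bounded_clinearD)
  from att obtain x where x: "x \<in> M" "norm x = 1"
    and eq: "norm (T x) = Inf {norm (T y) |y. y \<in> M \<and> norm y = 1}"
    by (auto simp: min_attaining_on_def min_modulus_on_def)
  have cs: "csubspace M" using M by (simp add: mem_reducing_subspaces)
  have min: "norm (T x) * norm y \<le> norm (T y)" if y: "y \<in> M" for y
  proof (cases "y = 0")
    case False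
    have "norm (T x) \<le> norm (T ((1 / norm y) *\<^sub>R y))"
      unfolding eq using False csubspace_scaleR[OF cs y, of "1 / norm y"]
      by (intro cInf_lower bdd_belowI[where m=0]) fastforce+
    then show ?thesis using False by (simp add: T.scaleR field_simps)
  qed simp
  define \<mu> where "\<mu> = norm (T x)"
  \<comment> \<open>The residual serves as its own test direction: it lies in \<open>M\<close>
    because \<open>M\<close> reduces \<open>T\<close>, and the linear coefficient becomes
    \<open>inner z z\<close>.\<close>
  define z where "z = cadjoint T (T x) - \<mu>\<^sup>2 *\<^sub>R x"
  have z: "z \<in> M"
    using M x csubspace_scaleR[OF cs] complex_vector.subspace_diff[OF cs]
    by (auto simp: z_def mem_reducing_subspaces)
  have "0 \<le> 2 * t * inner z z + t\<^sup>2 * ((norm (T z))\<^sup>2 - \<mu>\<^sup>2 * (norm z)\<^sup>2)" for t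
  proof -
    have "x + t *\<^sub>R z \<in> M" using x z csubspace_scaleR[OF cs] complex_vector.subspace_add[OF cs] by blast
    from power_mono[OF min[OF this], of 2]
    have "\<mu>\<^sup>2 * (norm (x + t *\<^sub>R z))\<^sup>2 \<le> (norm (T x + t *\<^sub>R T z))\<^sup>2"
      by (simp add: \<mu>_def power_mult_distrib T.add T.scaleR)
    moreover have ex: "(norm (u + t *\<^sub>R v))\<^sup>2 = (norm u)\<^sup>2 + 2 * (t * inner u v) + t\<^sup>2 * (norm v)\<^sup>2"
      for u v :: 'a
      unfolding power2_norm_eq_inner
      by (simp add: inner_add_left inner_add_right inner_commute power2_eq_square)
    moreover have "inner (T x) (T z) = inner z z + \<mu>\<^sup>2 * inner x z"
    proof -
      have "inner (T x) (T z) = inner z (z + \<mu>\<^sup>2 *\<^sub>R x)"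
        using inner_cadjoint[OF T, of z "T x"] by (simp add: z_def inner_commute)
      then show ?thesis by (simp add: inner_add_right inner_commute)
    qed
    moreover have "(norm (T x))\<^sup>2 = \<mu>\<^sup>2 * (norm x)\<^sup>2" using x by (simp add: \<mu>_def)
    ultimately show ?thesis by (simp add: algebra_simps)
  qed
  from quadratic_nonneg_imp_linear_0[OF this] have "z = 0" by simp
  then have "cadjoint T (T x) = (norm (T x))\<^sup>2 *\<^sub>R x" by (simp add: z_def \<mu>_def)
  with x min that show thesis by blast
qed

text \<open>The relation is always a linear order on \<open>\<Lambda>\<close>, so only
  well-foundedness matters, and minimal elements of a linear order are least.\<close>

lemma well_order_on_le_iff:
  fixes \<Lambda> :: "'a::linorder set"
  shows "well_order_on \<Lambda> {(x, y). x \<in> \<Lambda> \<and> y \<in> \<Lambda> \<and> x \<le> y} \<longleftrightarrow>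
    (\<forall>\<Gamma>\<subseteq>\<Lambda>. \<Gamma> \<noteq> {} \<longrightarrow> (\<exists>m\<in>\<Gamma>. \<forall>x\<in>\<Gamma>. m \<le> x))" (is "well_order_on \<Lambda> ?r \<longleftrightarrow> ?R")
proof -
  have "linear_order_on \<Lambda> ?r"
    by (auto simp: order_on_defs refl_on_def trans_def antisym_def total_on_def)
  then have "well_order_on \<Lambda> ?r \<longleftrightarrow> wf (?r - Id)" by (simp add: well_order_on_def)
  also have "\<dots> \<longleftrightarrow> ?R"
  proof
    assume wf: "wf (?r - Id)"
    show ?R
    proof (intro allI impI)
      fix \<Gamma> assume \<Gamma>: "\<Gamma> \<subseteq> \<Lambda>" "\<Gamma> \<noteq> {}"
      from wfE_min'[OF wf this(2)] obtain z
        where z: "z \<in> \<Gamma>" "\<And>y. (y, z) \<in> ?r - Id \<Longrightarrow> y \<notin> \<Gamma>" by blast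
      have "z \<le> x" if "x \<in> \<Gamma>" for x
        using z(2)[of x] that z(1) \<Gamma>(1) by fastforce
      with z(1) show "\<exists>m\<in>\<Gamma>. \<forall>x\<in>\<Gamma>. m \<le> x" by blast
    qed
  next
    assume R: ?R
    show "wf (?r - Id)" unfolding wf_eq_minimal
    proof (intro allI impI)
      fix Q :: "'a set" and q assume q: "q \<in> Q"
      show "\<exists>z\<in>Q. \<forall>y. (y, z) \<in> ?r - Id \<longrightarrow> y \<notin> Q"
      \<comment> \<open>\<open>Q\<close> may leave \<open>\<Lambda>\<close>; if it misses
        \<open>\<Lambda>\<close>, every element is minimal because the relation lives on
        \<open>\<Lambda>\<close>.\<close>
      proof (cases "Q \<inter> \<Lambda> = {}")
        case False
        with R obtain m where m: "m \<in> Q \<inter> \<Lambda>" "\<forall>x\<in>Q \<inter> \<Lambda>. m \<le> x" by (meson inf_le2)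
        have "y \<notin> Q" if y: "(y, m) \<in> ?r - Id" for y
        proof
          assume "y \<in> Q"
          with m(2) y have "m \<le> y" by blast
          moreover have "y \<le> m" "y \<noteq> m" using y by auto
          ultimately show False by simp
        qed
        with m(1) show ?thesis by blast
      qed (use q in blast)
    qed
  qed
  finally show ?thesis .
qed

lemma has_sum_singleI:
  assumes "l \<in> A" "\<And>m. m \<in> A \<Longrightarrow> m \<noteq> l \<Longrightarrow> f m = 0"
  shows "(f has_sum f l) A"
  using assms by (intro has_sum_finite_neutralI[of "{l}"]) auto

section \<open>The spectral form implies minimum attainment\<close>

text \<open>The data of condition (ii), with operator identities read pointwise and the well-order
  as a least-element principle.\<close>

locale spectral_form =
  fixes T :: "'a::chilbert_space \<Rightarrow> 'a" and \<Lambda> :: "real set" and P V :: "real \<Rightarrow> 'a \<Rightarrow> 'a"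
  assumes T: "bounded_clinear T"
    and nonneg: "\<And>l. l \<in> \<Lambda> \<Longrightarrow> 0 \<le> l"
    and least: "\<And>\<Gamma>. \<Gamma> \<subseteq> \<Lambda> \<Longrightarrow> \<Gamma> \<noteq> {} \<Longrightarrow> \<exists>m\<in>\<Gamma>. \<forall>x\<in>\<Gamma>. m \<le> x"
    and P: "\<And>l. l \<in> \<Lambda> \<Longrightarrow> orth_projection (P l)"
    and P_orth: "\<And>l m x. l \<in> \<Lambda> \<Longrightarrow> m \<in> \<Lambda> \<Longrightarrow> l \<noteq> m \<Longrightarrow> P l (P m x) = 0"
    and V: "\<And>l. l \<in> \<Lambda> - {0} \<Longrightarrow> bounded_clinear (V l)"
    and P_sum: "\<And>x. ((\<lambda>l. P l x) has_sum x) \<Lambda>"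
    and VV: "\<And>l m x. l \<in> \<Lambda> - {0} \<Longrightarrow> m \<in> \<Lambda> - {0} \<Longrightarrow>
      cadjoint (V m) (V l x) = (if m = l then P l x else 0)"
    and T_sum: "\<And>x. ((\<lambda>l. l *\<^sub>R V l x) has_sum T x) (\<Lambda> - {0})"
begin

lemma P_idem: "l \<in> \<Lambda> \<Longrightarrow> P l (P l x) = P l x"
  using P[of l] by (auto simp: orth_projection_def fun_eq_iff)

lemma P_sym: "l \<in> \<Lambda> \<Longrightarrow> inner (P l x) y = inner x (P l y)"
  using P[of l] cadjoint_self_iff[of "P l"] by (auto simp: orth_projection_def)

text \<open>Pairing with \<open>V l x\<close> removes every term of the series for
  \<open>T y\<close> except the one at \<open>l\<close>.\<close>

lemma inner_V_T:
  assumes l: "l \<in> \<Lambda> - {0}"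
  shows "inner (V l x) (T y) = l * inner (P l x) y"
proof -
  have "((\<lambda>m. inner (V l x) (m *\<^sub>R V m y)) has_sum inner (V l x) (T y)) (\<Lambda> - {0})"
    by (rule has_sum_bounded_linear[OF bounded_linear_inner_right T_sum])
  moreover have eq: "inner (V l x) (m *\<^sub>R V m y) = (if m = l then l * inner (P l x) y else 0)"
    if "m \<in> \<Lambda> - {0}" for m
    using inner_cadjoint[OF V[OF that], of y "V l x"] VV[OF l that] by (simp add: inner_commute)
  then have "((\<lambda>m. inner (V l x) (m *\<^sub>R V m y)) has_sum inner (V l x) (l *\<^sub>R V l y)) (\<Lambda> - {0})"
    using l by (intro has_sum_singleI) auto
  ultimately show ?thesis using eq[OF l] has_sum_unique by fastforce
qed

text \<open>The weak form of the expansion of \<open>T* T\<close> as the sum of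
  \<open>l\<^sup>2 P l\<close>; the index 0 contributes nothing and may be restored.\<close>

lemma inner_T_T: "((\<lambda>l. l\<^sup>2 * inner (P l x) y) has_sum inner (T x) (T y)) \<Lambda>"
proof -
  have "((\<lambda>l. inner (l *\<^sub>R V l x) (T y)) has_sum inner (T x) (T y)) (\<Lambda> - {0})"
    by (rule has_sum_bounded_linear[OF bounded_linear_inner_left T_sum])
  then show ?thesis
    by (subst has_sum_cong_neutral[of "\<Lambda> - {0}"]) (auto simp: inner_V_T power2_eq_square)
qed

text \<open>In weak form, the range of \<open>P m\<close> consists of eigenvectors of
  \<open>T* T\<close> for \<open>m\<^sup>2\<close>.\<close>

lemma inner_T_P_T:
  assumes m: "m \<in> \<Lambda>"
  shows "inner (T (P m x)) (T y) = m\<^sup>2 * inner (P m x) y"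
proof -
  have "((\<lambda>l. l\<^sup>2 * inner (P l (P m x)) y) has_sum m\<^sup>2 * inner (P m (P m x)) y) \<Lambda>"
    using m P_orth by (intro has_sum_singleI) auto
  with inner_T_T[of "P m x" y] show ?thesis using has_sum_unique P_idem[OF m] by fastforce
qed

text \<open>With \<open>l\<close> the least index such that \<open>P l\<close> does not vanish on \<open>M\<close> and \<open>x \<in> M\<close>, \<open>P l x \<noteq> 0\<close>, the
  projection of \<open>P l x\<close> to \<open>M\<close> is a minimal vector; it is nonzero since its inner product with \<open>x\<close>
  is \<open>(norm (P l x))\<^sup>2\<close>.\<close>

lemma min_attaining_on_reducing:
  assumes M: "M \<in> reducing_subspaces T" and "M \<noteq> {0}"
  shows "min_attaining_on M T"
proof -
  have cs: "csubspace M" and cl: "closed M" and A: "\<And>x. x \<in> M \<Longrightarrow> cadjoint T (T x) \<in> M"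
    using M by (auto simp: mem_reducing_subspaces)
  interpret T: bounded_linear T using T by (rule bounded_clinearD)
  define \<Gamma> where "\<Gamma> = {l \<in> \<Lambda>. \<exists>x\<in>M. P l x \<noteq> 0}"
  obtain x0 where "x0 \<in> M" "x0 \<noteq> 0" using \<open>M \<noteq> {0}\<close> complex_vector.subspace_0[OF cs] by blast
  then have "\<Gamma> \<noteq> {}"
    using has_sum_unique[OF P_sum[of x0] has_sum_0[of \<Lambda> "\<lambda>l. P l x0"]] by (auto simp: \<Gamma>_def)
  then obtain l where l: "l \<in> \<Gamma>" and l_least: "\<And>m. m \<in> \<Gamma> \<Longrightarrow> l \<le> m"
    using least[of \<Gamma>] by (auto simp: \<Gamma>_def)
  then obtain x where x: "x \<in> M" "P l x \<noteq> 0" and l\<Lambda>: "l \<in> \<Lambda>" by (auto simp: \<Gamma>_def)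
  define z where "z = P l x"
  define g where "g = proj M z"
  have gM: "g \<in> M" unfolding g_def by (rule proj_in[OF cs cl])
  have g: "inner g y = inner z y" if "y \<in> M" for y unfolding g_def by (rule inner_proj[OF cs cl that])
  have "inner g x = inner z z"
    using g[OF x(1)] P_sym[OF l\<Lambda>, of "P l x" x] P_idem[OF l\<Lambda>] by (simp add: z_def)
  then have "g \<noteq> 0" using x(2) by (auto simp: z_def)
  have "(norm (T g))\<^sup>2 = inner g (cadjoint T (T g))"
    by (simp add: power2_norm_eq_inner inner_cadjoint[OF T])
  \<comment> \<open>The vector \<open>cadjoint T (T g)\<close> stays in \<open>M\<close>, where
    pairing with \<open>g\<close> and with \<open>z\<close> agree; then the eigenvector property of
    \<open>z\<close> applies.\<close>
  also have "\<dots> = inner z (cadjoint T (T g))" using g A gM by blast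
  also have "\<dots> = l\<^sup>2 * inner z g" by (simp add: inner_cadjoint[OF T, symmetric] z_def inner_T_P_T[OF l\<Lambda>])
  also have "\<dots> = (l * norm g)\<^sup>2"
    using g[OF gM] by (simp add: power_mult_distrib power2_norm_eq_inner)
  finally have Tg: "norm (T g) = l * norm g"
    using nonneg[OF l\<Lambda>] by (simp only: power2_eq_iff_nonneg norm_ge_zero mult_nonneg_nonneg)
  \<comment> \<open>The expansions of \<open>inner y y\<close> and \<open>inner (T y) (T y)\<close>
    are compared termwise; terms with index below \<open>l\<close> vanish on \<open>M\<close> by the
    choice of \<open>l\<close>.\<close>
  have lower: "l * norm y \<le> norm (T y)" if y: "y \<in> M" for y
  proof -
    have "((\<lambda>m. inner (P m y) y) has_sum inner y y) \<Lambda>"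
      by (rule has_sum_bounded_linear[OF bounded_linear_inner_left P_sum])
    then have "((\<lambda>m. l\<^sup>2 * inner (P m y) y) has_sum l\<^sup>2 * inner y y) \<Lambda>"
      by (rule has_sum_cmult_right)
    then have "l\<^sup>2 * inner y y \<le> inner (T y) (T y)"
    proof (rule has_sum_mono[OF _ inner_T_T])
      fix m assume m: "m \<in> \<Lambda>"
      have "inner (P m y) y = inner (P m y) (P m y)" using P_sym[OF m, of "P m y" y] P_idem[OF m] by simp
      then have pos: "0 \<le> inner (P m y) y" by simp
      show "l\<^sup>2 * inner (P m y) y \<le> m\<^sup>2 * inner (P m y) y"
      proof (cases "P m y = 0")
        case False
        then have "l \<le> m" using m y l_least by (auto simp: \<Gamma>_def)
        then show ?thesis using pos nonneg[OF l\<Lambda>] by (intro mult_right_mono power_mono)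
      qed simp
    qed
    then have "(l * norm y)\<^sup>2 \<le> (norm (T y))\<^sup>2" by (simp add: power_mult_distrib power2_norm_eq_inner)
    then show ?thesis by (rule power2_le_imp_le) simp
  qed
  have "norm (T ((1 / norm g) *\<^sub>R g)) = l" using \<open>g \<noteq> 0\<close> Tg by (simp add: T.scaleR)
  then show ?thesis
    using \<open>g \<noteq> 0\<close> lower csubspace_scaleR[OF cs gM]
    by (intro min_attaining_onI[of "(1 / norm g) *\<^sub>R g"]) auto
qed

end

section \<open>Minimum attainment implies the spectral form\<close>

text \<open>The space of right singular vectors for \<open>l\<close>. Since \<open>l\<close> and
  \<open>-l\<close> give the same space, the index is later restricted to nonnegative
  values.\<close>

definition eig :: "('a::chilbert_space \<Rightarrow> 'a) \<Rightarrow> real \<Rightarrow> 'a set" where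
  "eig T l = {x. cadjoint T (T x) = l\<^sup>2 *\<^sub>R x}"

text \<open>The modulus is self-adjoint and commutes with its square \<open>T* T\<close>, so it
  preserves the eigenspaces of that square.\<close>

lemma eig_reduces_abs_op:
  assumes T: "bounded_clinear T"
  shows "eig T l \<in> reducing_subspaces (abs_op T)"
proof -
  define A where "A x = cadjoint T (T x)" for x
  have A: "bounded_clinear A"
    unfolding A_def[abs_def] by (rule bounded_clinear_compose[OF bounded_clinear_cadjoint[OF T] T])
  interpret A: bounded_linear A using A by (rule bounded_clinearD)
  define R where "R = abs_op T"
  have R: "positive_op R" and RR: "\<And>x. R (R x) = A x"
    unfolding R_def A_def using positive_abs_op[OF T] abs_op_abs_op[OF T] by auto
  then have Rl: "bounded_clinear R" by (simp add: positive_op_def)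
  interpret R: bounded_linear R using Rl by (rule bounded_clinearD)
  have "cadjoint R = R" using positive_op_inner_sym[OF R] by (simp add: cadjoint_self_iff[OF Rl])
  moreover have E: "eig T l = {x. A x = l\<^sup>2 *\<^sub>R x}" by (simp add: eig_def A_def)
  moreover have "R x \<in> eig T l" if "x \<in> eig T l" for x
    using that by (simp add: E RR[symmetric] R.scaleR)
  moreover have "csubspace (eig T l)"
    by (auto simp: E complex_vector.subspace_def A.add A.zero bounded_clinearD(3)[OF A] scaleR_add_right
        scaleC_scaleR)
  moreover have "closed (eig T l)"
    unfolding E by (intro closed_Collect_eq continuous_intros A.continuous_on)
  ultimately show ?thesis by (simp add: mem_reducing_subspaces R_def)
qed

lemma norm_eig:
  assumes T: "bounded_clinear T" and x: "x \<in> eig T l" and l: "0 \<le> l"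
  shows "norm (T x) = l * norm x"
proof -
  have "(norm (T x))\<^sup>2 = (l * norm x)\<^sup>2"
    using x inner_cadjoint[OF T, of x "T x"] by (simp add: eig_def power2_norm_eq_inner power_mult_distrib)
  then show ?thesis using l by (simp only: power2_eq_iff_nonneg norm_ge_zero mult_nonneg_nonneg)
qed

text \<open>Evaluate \<open>inner (T x) (T y)\<close> from either side; nonnegativity of the indices
  makes their squares distinct.\<close>

lemma inner_eig_eq_0:
  assumes T: "bounded_clinear T" and x: "x \<in> eig T l" and y: "y \<in> eig T m"
    and "0 \<le> l" "0 \<le> m" "l \<noteq> m"
  shows "inner x y = 0"
proof -
  have "inner (T x) (T y) = l\<^sup>2 * inner x y"
    using x inner_cadjoint[OF T, of y "T x"] by (simp add: eig_def inner_commute)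
  moreover have "inner (T x) (T y) = m\<^sup>2 * inner x y"
    using y inner_cadjoint[OF T, of x "T y"] by (simp add: eig_def)
  moreover have "l\<^sup>2 \<noteq> m\<^sup>2" using assms by (simp add: power2_eq_iff_nonneg)
  ultimately show ?thesis by simp
qed

locale eigen_reducing =
  fixes T :: "'a::chilbert_space \<Rightarrow> 'a"
  assumes T: "bounded_clinear T"
    and eig_reducing: "\<And>l. eig T l \<in> reducing_subspaces T"
begin

section \<open>Singular values, spectral projections and partial isometries\<close>

definition \<Lambda> :: "real set" where "\<Lambda> = {l. 0 \<le> l \<and> eig T l \<noteq> {0}}"

definition P :: "real \<Rightarrow> 'a \<Rightarrow> 'a" where "P l = proj (eig T l)"

text \<open>On \<open>eig T l\<close> the operator \<open>T\<close> scales norms by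
  \<open>l\<close>, so for positive \<open>l\<close> division by \<open>l\<close> makes it isometric
  there.\<close>

definition V :: "real \<Rightarrow> 'a \<Rightarrow> 'a" where "V l x = (1 / l) *\<^sub>R T (P l x)"

sublocale T: bounded_linear T using T by (rule bounded_clinearD)

lemma eig_csubspace: "csubspace (eig T l)" and eig_closed: "closed (eig T l)"
  using eig_reducing[of l] by (auto simp: mem_reducing_subspaces)

lemmas P_props = eig_csubspace eig_closed

lemma P_eig: "P l x \<in> eig T l" unfolding P_def by (rule proj_in[OF P_props])

lemma P_clinear: "bounded_clinear (P l)" unfolding P_def by (rule bounded_clinear_proj[OF P_props])

lemma eig_nonzero: "l \<in> \<Lambda> \<Longrightarrow> \<exists>x\<in>eig T l. x \<noteq> 0"
  using complex_vector.subspace_0[OF eig_csubspace[of l]] by (auto simp: \<Lambda>_def)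

lemma \<Lambda>_nonneg: "l \<in> \<Lambda> \<Longrightarrow> 0 \<le> l" by (simp add: \<Lambda>_def)

lemma mem_\<Lambda>: "x \<in> eig T l \<Longrightarrow> x \<noteq> 0 \<Longrightarrow> 0 \<le> l \<Longrightarrow> l \<in> \<Lambda>" by (auto simp: \<Lambda>_def)

lemma \<Lambda>_le_onorm:
  assumes l: "l \<in> \<Lambda>"
  shows "l \<le> onorm T"
proof -
  obtain x where x: "x \<in> eig T l" "x \<noteq> 0" using eig_nonzero[OF l] by blast
  have "l * norm x \<le> onorm T * norm x"
    using norm_eig[OF T x(1) \<Lambda>_nonneg[OF l]] onorm[OF T.bounded_linear_axioms, of x] by simp
  then show ?thesis using x(2) by simp
qed

lemma P_orth:
  assumes "l \<in> \<Lambda>" "m \<in> \<Lambda>" "l \<noteq> m" "x \<in> eig T m"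
  shows "P l x = 0"
  unfolding P_def
proof (rule proj_unique[OF P_props])
  show "0 \<in> eig T l" by (rule complex_vector.subspace_0[OF eig_csubspace])
  show "inner 0 v = inner x v" if "v \<in> eig T l" for v
    using inner_eig_eq_0[OF T assms(4) that] assms \<Lambda>_nonneg by simp
qed

lemma P_self: "x \<in> eig T l \<Longrightarrow> P l x = x"
  unfolding P_def by (rule proj_fixed[OF P_props])

lemma orth_complement_eigs_reducing:
  "orth_complement (\<Union>l\<in>\<Gamma>. eig T l) \<in> reducing_subspaces T"
  using eig_reducing by (intro orth_complement_reducing T) (auto simp: mem_reducing_subspaces)

text \<open>Mutual orthogonality of the ranges gives \<open>inner s s = inner s x\<close> for the
  partial sum \<open>s\<close>. The bound, uniform in \<open>F\<close>, controls limits of the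
  series.\<close>

lemma norm_sum_P_le:
  assumes F: "finite F" "F \<subseteq> \<Lambda>"
  shows "norm (\<Sum>l\<in>F. P l x) \<le> norm x"
proof -
  define s where "s = (\<Sum>l\<in>F. P l x)"
  have "inner (P l x) s = inner (P l x) x" if l: "l \<in> F" for l
  proof -
    have "inner (P l x) s = (\<Sum>m\<in>F. inner (P l x) (P m x))" by (simp add: s_def inner_sum_right)
    also have "\<dots> = (\<Sum>m\<in>{l}. inner (P l x) (P m x))"
      using F l inner_eig_eq_0[OF T P_eig P_eig] \<Lambda>_nonneg by (intro sum.mono_neutral_right) blast+
    also have "\<dots> = inner (P l x) x"
      unfolding P_def using inner_proj_right[OF P_props proj_in[OF P_props]] by simp
    finally show ?thesis .
  qed
  then have "inner s s = inner s x"
    by (subst (1 3) s_def) (simp add: inner_sum_left)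
  then have "norm s * norm s \<le> norm s * norm x"
    using norm_cauchy_schwarz[of s x] by (simp add: power2_norm_eq_inner[symmetric] power2_eq_square)
  then show ?thesis by (cases "s = 0") (auto simp: s_def[symmetric])
qed

lemma countable_\<Lambda>:
  assumes "separable_space (euclidean :: 'a topology)"
  shows "countable \<Lambda>"
proof -
  obtain C :: "'a set" where C: "countable C" "closure C = UNIV"
    using assms by (auto simp: separable_space_def)
  have "\<exists>u\<in>eig T l. norm u = 1" if "l \<in> \<Lambda>" for l
  proof -
    obtain x where "x \<in> eig T l" "x \<noteq> 0" using eig_nonzero[OF \<open>l \<in> \<Lambda>\<close>] by blast
    then show ?thesis
      using csubspace_scaleR[OF eig_csubspace, of x l "1 / norm x"] by (intro bexI[of _ "(1 / norm x) *\<^sub>R x"]) auto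
  qed
  then obtain u where u: "\<And>l. l \<in> \<Lambda> \<Longrightarrow> u l \<in> eig T l" "\<And>l. l \<in> \<Lambda> \<Longrightarrow> norm (u l) = 1" by metis
  \<comment> \<open>Orthogonal unit vectors are \<open>sqrt 2\<close> apart, so radius 1/2 makes the
    chosen points of \<open>C\<close> distinct for distinct indices.\<close>
  have "\<exists>c\<in>C. dist c (u l) < 1 / 2" for l
    using C(2) closure_approachable[THEN iffD1, rule_format, of "u l" C "1 / 2"] by simp
  then obtain f where f: "\<And>l. f l \<in> C" "\<And>l. dist (f l) (u l) < 1 / 2" by metis
  have "inj_on f \<Lambda>"
  proof (rule inj_onI, rule ccontr)
    fix l m assume lm: "l \<in> \<Lambda>" "m \<in> \<Lambda>" "f l = f m" "l \<noteq> m"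
    have "dist (u l) (u m) < 1" using f(2)[of l] f(2)[of m] lm(3) by metric
    then have "(norm (u l - u m))\<^sup>2 < 1" by (simp add: dist_norm abs_square_less_1)
    moreover have "(norm (u l - u m))\<^sup>2 = (norm (u l))\<^sup>2 - 2 * inner (u l) (u m) + (norm (u m))\<^sup>2"
      unfolding power2_norm_eq_inner by (simp add: inner_diff_left inner_diff_right inner_commute)
    ultimately show False
      using u lm inner_eig_eq_0[OF T u(1) u(1)] \<Lambda>_nonneg by simp
  qed
  moreover have "countable (f ` \<Lambda>)" using C(1) f(1) by (meson countable_subset image_subsetI)
  ultimately show ?thesis by (rule countable_image_inj_on[rotated])
qed

lemma V_clinear: "bounded_clinear (V l)"
  unfolding V_def[abs_def] by (intro bounded_clinear_scaleR bounded_clinear_compose[OF T P_clinear])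

lemma norm_V: "l \<in> \<Lambda> - {0} \<Longrightarrow> norm (V l x) = norm (P l x)"
  using norm_eig[OF T P_eig, of l x] \<Lambda>_nonneg[of l] by (simp add: V_def)

text \<open>For \<open>x\<close> orthogonal to the kernel, \<open>x - P l x\<close> lies in the
  kernel and is orthogonal to both \<open>x\<close> and \<open>P l x\<close>, hence is zero.\<close>

lemma partial_isometry_V:
  assumes l: "l \<in> \<Lambda> - {0}"
  shows "partial_isometry (V l)"
  unfolding partial_isometry_def
proof (intro conjI V_clinear ballI)
  fix x assume x: "x \<in> orth_complement {z. V l z = 0}"
  have "P l (x - P l x) = 0"
    using linear_diff[OF bounded_clinearD(2)[OF P_clinear]] P_self[OF P_eig] by simp
  then have "V l (x - P l x) = 0" using norm_V[OF l, of "x - P l x"] by simp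
  with x have "cinner x (x - P l x) = 0" by (simp add: orth_complement_def)
  then have "inner x (x - P l x) = 0" by (simp add: Re_cinner[symmetric])
  moreover have "inner (P l x) (x - P l x) = 0"
    unfolding P_def using inner_proj_right[OF P_props proj_in[OF P_props]] by (simp add: inner_diff_right)
  ultimately have "inner (x - P l x) (x - P l x) = 0" by (simp add: inner_diff_left)
  then show "norm (V l x) = norm x" by (simp add: norm_V[OF l])
qed

lemma cadjoint_V_V:
  assumes l: "l \<in> \<Lambda> - {0}" and m: "m \<in> \<Lambda> - {0}"
  shows "cadjoint (V m) (V l x) = (if m = l then P l x else 0)"
proof (rule inner_ext)
  fix y
  have "inner (cadjoint (V m) (V l x)) y = inner (V m y) (V l x)"
    by (metis inner_cadjoint[OF V_clinear] inner_commute)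
  also have "\<dots> = 1 / (l * m) * inner (P m y) (cadjoint T (T (P l x)))"
    by (simp add: V_def inner_cadjoint[OF T])
  also have "\<dots> = l / m * inner (P m y) (P l x)"
    using P_eig[of l x] l by (simp add: eig_def power2_eq_square)
  also have "\<dots> = inner (if m = l then P l x else 0) y"
    using l m inner_eig_eq_0[OF T P_eig P_eig, of m l] \<Lambda>_nonneg inner_proj[OF P_props proj_in[OF P_props], of l y x]
    by (auto simp: P_def[symmetric] inner_commute)
  finally show "inner (cadjoint (V m) (V l x)) y = inner (if m = l then P l x else 0) y" .
qed

section \<open>Least singular values and completeness of the eigenspaces\<close>

context
  assumes min_att: "T \<in> min_attaining_reducing"
begin

lemma reducing_minimal:
  assumes M: "M \<in> reducing_subspaces T" "M \<noteq> {0}"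
  obtains x l where "x \<in> M" "x \<noteq> 0" "x \<in> eig T l" "l \<in> \<Lambda>" "\<forall>y\<in>M. l * norm y \<le> norm (T y)"
proof -
  have "min_attaining_on M T" using min_att M by (simp add: min_attaining_reducing_def)
  from min_attaining_onD[OF T M(1) this] obtain x where x: "x \<in> M" "norm x = 1"
    "cadjoint T (T x) = (norm (T x))\<^sup>2 *\<^sub>R x" "\<And>y. y \<in> M \<Longrightarrow> norm (T x) * norm y \<le> norm (T y)"
    by blast
  then have "x \<noteq> 0" "x \<in> eig T (norm (T x))" by (auto simp: eig_def)
  with x that mem_\<Lambda> show thesis by (meson norm_ge_zero)
qed

lemma \<Lambda>_least:
  assumes "\<Gamma> \<subseteq> \<Lambda>" "\<Gamma> \<noteq> {}"
  shows "\<exists>m\<in>\<Gamma>. \<forall>l\<in>\<Gamma>. m \<le> l"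
proof -
  define X where "X = (\<Union>l\<in>\<Gamma>. eig T l)"
  \<comment> \<open>The closed span of the chosen eigenspaces, written as a double complement so
    that it is visibly reducing.\<close>
  define M where "M = orth_complement (orth_complement X)"
  have red: "M \<in> reducing_subspaces T"
    using orth_complement_eigs_reducing[of \<Gamma>] unfolding M_def X_def
    by (intro orth_complement_reducing T) (auto simp: mem_reducing_subspaces)
  have XM: "X \<subseteq> M"
  proof
    fix x assume x: "x \<in> X"
    have "cinner x y = 0" if "y \<in> orth_complement X" for y
      using that x cinner_commute[of x y] by (simp add: orth_complement_def)
    then show "x \<in> M" by (simp add: M_def orth_complement_def[of "orth_complement X"])
  qed
  have ne: "M \<noteq> {0}"
  proof -
    obtain l where l: "l \<in> \<Gamma>" using assms(2) by blast
    obtain y where y: "y \<in> eig T l" "y \<noteq> 0" using eig_nonzero[OF subsetD[OF assms(1) l]] by blast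
    have "y \<in> M" using XM l y(1) by (auto simp: X_def)
    with y(2) show ?thesis by blast
  qed
  obtain x m where x: "x \<in> M" "x \<noteq> 0" "x \<in> eig T m" "m \<in> \<Lambda>"
    and min: "\<forall>y\<in>M. m * norm y \<le> norm (T y)"
    by (rule reducing_minimal[OF red ne])
  have "m \<in> \<Gamma>"
  proof (rule ccontr)
    assume "m \<notin> \<Gamma>"
    \<comment> \<open>An eigenvector for an index outside \<open>\<Gamma>\<close> is orthogonal to
      all of \<open>X\<close>, but as an element of \<open>M\<close> it is orthogonal to that
      complement, hence to itself.\<close>
    have "x \<in> orth_complement X"
    proof -
      have "x \<in> orth_complement (eig T l)" if "l \<in> \<Gamma>" for l
      proof (rule orth_complement_csubspaceI[OF eig_csubspace])
        fix v assume v: "v \<in> eig T l"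
        show "inner x v = 0"
          using \<open>m \<notin> \<Gamma>\<close> that \<Lambda>_nonneg[OF x(4)] \<Lambda>_nonneg[OF subsetD[OF assms(1) that]]
          by (intro inner_eig_eq_0[OF T x(3) v]) auto
      qed
      then show ?thesis by (auto simp: X_def orth_complement_def)
    qed
    with x(1) have "cinner x x = 0" by (simp add: M_def orth_complement_def[of "orth_complement X"])
    with x(2) show False by (simp add: cinner_self)
  qed
  moreover have "m \<le> l" if l: "l \<in> \<Gamma>" for l
  proof -
    obtain y where y: "y \<in> eig T l" "y \<noteq> 0" using eig_nonzero[OF subsetD[OF assms(1) l]] by blast
    then have "y \<in> M" using XM l by (auto simp: X_def)
    with min have "m * norm y \<le> l * norm y"
      using norm_eig[OF T y(1) \<Lambda>_nonneg[OF subsetD[OF assms(1) l]]] by metis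
    then show ?thesis using y(2) by simp
  qed
  ultimately show ?thesis by blast
qed

text \<open>A nonzero complement would contain an eigenvector, which would be orthogonal to
  itself.\<close>

lemma orth_complement_eigs: "orth_complement (\<Union>l\<in>\<Lambda>. eig T l) = {0}"
proof (rule ccontr)
  assume "orth_complement (\<Union>l\<in>\<Lambda>. eig T l) \<noteq> {0}"
  then obtain x l where "x \<in> orth_complement (\<Union>l\<in>\<Lambda>. eig T l)" "x \<noteq> 0" "x \<in> eig T l" "l \<in> \<Lambda>"
    using reducing_minimal[OF orth_complement_eigs_reducing] by blast
  then have "cinner x x = 0" by (auto simp: orth_complement_def)
  with \<open>x \<noteq> 0\<close> show False by (simp add: cinner_self)
qed

text \<open>The vectors with a valid expansion form a closed subspace \<open>G\<close> containing
  all eigenspaces; the residual of projecting to \<open>G\<close> is orthogonal to them and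
  therefore zero.\<close>

lemma P_sum: "((\<lambda>l. P l x) has_sum x) \<Lambda>"
proof -
  define G where "G = {x. ((\<lambda>l. P l x) has_sum x) \<Lambda>}"
  have G: "csubspace G"
    using linear_0[OF bounded_clinearD(2)[OF P_clinear]] linear_add[OF bounded_clinearD(2)[OF P_clinear]]
      bounded_clinearD(3)[OF P_clinear] has_sum_bounded_linear[OF bounded_linear_scaleC]
    by (auto simp: G_def complex_vector.subspace_def intro: has_sum_add)
  \<comment> \<open>Partial sums are contractions uniformly in \<open>F\<close>, so an
    \<open>e / 3\<close> argument passes convergence to the limit.\<close>
  have "closed G" unfolding closed_sequential_limits
  proof (intro allI impI, elim conjE)
    fix X x assume X: "\<forall>n. X n \<in> G" "X \<longlonglongrightarrow> x"
    have "((\<lambda>F. \<Sum>l\<in>F. P l x) \<longlongrightarrow> x) (finite_subsets_at_top \<Lambda>)"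
    proof (rule tendstoI)
      fix e :: real assume "0 < e"
      then obtain n where n: "dist (X n) x < e / 3" 
        using X(2) metric_LIMSEQ_D[of X x "e / 3"] by auto
      have "((\<lambda>F. \<Sum>l\<in>F. P l (X n)) \<longlongrightarrow> X n) (finite_subsets_at_top \<Lambda>)"
        using X(1) by (simp add: G_def has_sum_def)
      from tendstoD[OF this, of "e / 3"] \<open>0 < e\<close>
      have "\<forall>\<^sub>F F in finite_subsets_at_top \<Lambda>. dist (\<Sum>l\<in>F. P l (X n)) (X n) < e / 3" by simp
      moreover have "\<forall>\<^sub>F F in finite_subsets_at_top \<Lambda>. finite F \<and> F \<subseteq> \<Lambda>" by auto
      ultimately show "\<forall>\<^sub>F F in finite_subsets_at_top \<Lambda>. dist (\<Sum>l\<in>F. P l x) x < e"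
      proof eventually_elim
        case (elim F)
        have "(\<Sum>l\<in>F. P l x) - (\<Sum>l\<in>F. P l (X n)) = (\<Sum>l\<in>F. P l (x - X n))"
          by (simp add: sum_subtractf linear_diff[OF bounded_clinearD(2)[OF P_clinear]])
        then have "dist (\<Sum>l\<in>F. P l x) (\<Sum>l\<in>F. P l (X n)) \<le> dist x (X n)"
          using norm_sum_P_le[of F "x - X n"] elim by (simp add: dist_norm)
        with elim n show ?case by metric
      qed
    qed
    then show "x \<in> G" by (simp add: G_def has_sum_def)
  qed
  have "eig T l \<subseteq> G" if "l \<in> \<Lambda>" for l
  proof
    fix y assume y: "y \<in> eig T l"
    then have "((\<lambda>m. P m y) has_sum P l y) \<Lambda>"
      using that P_orth by (intro has_sum_singleI) auto
    then show "y \<in> G" using P_self[OF y] by (simp add: G_def)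
  qed
  then have "x - proj G x \<in> orth_complement (\<Union>l\<in>\<Lambda>. eig T l)"
    using cinner_diff_proj[OF G \<open>closed G\<close>] by (auto simp: orth_complement_def)
  then have "x = proj G x" by (simp add: orth_complement_eigs)
  then show ?thesis using proj_in[OF G \<open>closed G\<close>, of x] by (simp add: G_def)
qed

lemma T_sum: "((\<lambda>l. l *\<^sub>R V l x) has_sum T x) (\<Lambda> - {0})"
proof -
  have "T (P 0 x) = 0" using norm_eig[OF T P_eig, of 0 x] by simp
  moreover have "((\<lambda>l. T (P l x)) has_sum T x) \<Lambda>"
    by (rule has_sum_bounded_linear[OF T.bounded_linear_axioms P_sum])
  ultimately show ?thesis
    by (subst has_sum_cong_neutral[of \<Lambda>]) (auto simp: V_def)
qed

end

end

theorem theorem7p3: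
  fixes T :: "'a::chilbert_space \<Rightarrow> 'a"
  assumes "infinite_dim_space TYPE('a)"
    and "separable_space (euclidean :: 'a topology)"
    and "bounded_clinear T"
    and "reducing_subspaces T = reducing_subspaces (abs_op T)"
  shows "T \<in> min_attaining_reducing \<longleftrightarrow>
    (\<exists>(\<Lambda> :: real set) (P :: real \<Rightarrow> 'a \<Rightarrow> 'a) (V :: real \<Rightarrow> 'a \<Rightarrow> 'a).
       countable \<Lambda> \<and> \<Lambda> \<subseteq> {0..onorm T} \<and>
       well_order_on \<Lambda> {(x, y). x \<in> \<Lambda> \<and> y \<in> \<Lambda> \<and> x \<le> y} \<and>
       (\<forall>l\<in>\<Lambda>. orth_projection (P l)) \<and>
       (\<forall>l\<in>\<Lambda>. \<forall>m\<in>\<Lambda>. l \<noteq> m \<longrightarrow> P l \<circ> P m = (\<lambda>_. 0)) \<and>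
       (\<forall>l\<in>\<Lambda> - {0}. partial_isometry (V l)) \<and>
       has_sum_sot P id \<Lambda> \<and>
       (\<forall>l\<in>\<Lambda> - {0}. \<forall>m\<in>\<Lambda> - {0}.
          cadjoint (V m) \<circ> V l = (if m = l then P l else (\<lambda>_. 0))) \<and>
       has_sum_sot (\<lambda>l x. l *\<^sub>R V l x) T (\<Lambda> - {0}))"
    (is "_ \<longleftrightarrow> (\<exists>\<Lambda> P V. ?spectral \<Lambda> P V)")
proof
  \<comment> \<open>The equality of the families of reducing subspaces enters here: the eigenspaces
    reduce \<open>abs_op T\<close>, hence \<open>T\<close>.\<close>
  interpret eigen_reducing T
    using assms(3,4) eig_reduces_abs_op by unfold_locales auto
  assume min: "T \<in> min_attaining_reducing"
  have "?spectral \<Lambda> P V"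
    unfolding well_order_on_le_iff has_sum_sot_def
  proof (intro conjI ballI allI impI)
    show "orth_projection (P l)" for l
      unfolding P_def by (rule orth_projection_proj[OF P_props])
    show "P l \<circ> P m = (\<lambda>_. 0)" if "l \<in> \<Lambda>" "m \<in> \<Lambda>" "l \<noteq> m" for l m
      using P_orth[OF that P_eig] by (simp add: fun_eq_iff)
  qed (use assms(2) countable_\<Lambda> \<Lambda>_nonneg \<Lambda>_le_onorm \<Lambda>_least[OF min] partial_isometry_V cadjoint_V_V
        P_sum[OF min] T_sum[OF min] in \<open>auto simp: fun_eq_iff\<close>)
  then show "\<exists>\<Lambda> P V. ?spectral \<Lambda> P V" by blast
next
  assume "\<exists>\<Lambda> P V. ?spectral \<Lambda> P V"
  then obtain \<Lambda> P V where s: "?spectral \<Lambda> P V" by blast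
  have P_sum: "((\<lambda>l. P l x) has_sum x) \<Lambda>" for x using s unfolding has_sum_sot_def id_def by blast
  have T_sum: "((\<lambda>l. l *\<^sub>R V l x) has_sum T x) (\<Lambda> - {0})" for x using s unfolding has_sum_sot_def by blast
  have VV: "cadjoint (V m) \<circ> V l = (if m = l then P l else (\<lambda>_. 0))"
    if "l \<in> \<Lambda> - {0}" "m \<in> \<Lambda> - {0}" for l m using s that by blast
  interpret spectral_form T \<Lambda> P V
  proof
    show "\<exists>m\<in>\<Gamma>. \<forall>x\<in>\<Gamma>. m \<le> x" if "\<Gamma> \<subseteq> \<Lambda>" "\<Gamma> \<noteq> {}" for \<Gamma>
      using s that unfolding well_order_on_le_iff by blast
    show "P l (P m x) = 0" if "l \<in> \<Lambda>" "m \<in> \<Lambda>" "l \<noteq> m" for l m x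
      using s that by (metis comp_apply)
    show "cadjoint (V m) (V l x) = (if m = l then P l x else 0)"
      if "l \<in> \<Lambda> - {0}" "m \<in> \<Lambda> - {0}" for l m x
      using fun_cong[OF VV[OF that], of x] by simp
  qed (use s assms(3) P_sum T_sum in \<open>auto simp: partial_isometry_def\<close>)
  show "T \<in> min_attaining_reducing"
    using assms(3) min_attaining_on_reducing by (simp add: min_attaining_reducing_def)
qed

end
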